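(* Let $G$ be a finite group with $G/Z(G) \cong D_{2n}$, where $n\ge 3$ and $D_{2n}$ is the dihedral group of order $2n$, and let $z = |Z(G)|$. Let $\Gamma_G$ be the commuting conjugacy class graph of $G$. If $n=3$ and $z\ge 1$, or $n=5$ and $z=1$, then $$E_{CN}(\Gamma_G) = LE_{CN}(\Gamma_G) = LE^+_{CN}(\Gamma_G).$$ In all other cases, $$E_{CN}(\Gamma_G) < LE^+_{CN}(\Gamma_G) < LE_{CN}(\Gamma_G).$$
   Context: For a finite non-abelian group $G$ with center $Z(G)$, the commuting conjugacy class graph (CCC-graph) $\Gamma_G$ is the simple undirected graph whose vertices are the conjugacy classes $x^G$ of non-central elements $x \in G \setminus Z(G)$; two distinct vertices $x^G, y^G$ are adjacent if there exist $x' \in x^G$ and $y' \in y^G$ with $x'y' = y'x'$. For a finite simple graph $\mathcal{G}$ with vertices $v_1,\dots,v_N$, let $CN(\mathcal{G})$ be the $N\times N$ matrix whose $(i,j)$ entry is, for $i\ne j$, the number of vertices other than $v_i,v_j$ adjacent to both $v_i$ and $v_j$, and whose diagonal entries are $0$. $E_{CN}(\mathcal{G})$ is the sum of the absolute values of the eigenvalues of $CN(\mathcal{G})$ (with multiplicity). Let $CNRS(\mathcal{G})$ be the diagonal matrix whose $i$-th diagonal entry is the $i$-th row sum of $CN(\mathcal{G})$. Put $CNL(\mathcal{G}) = CNRS(\mathcal{G}) - CN(\mathcal{G})$, $CNSL(\mathcal{G}) = CNRS(\mathcal{G}) + CN(\mathcal{G})$ and $\Delta(\mathcal{G}) = \operatorname{tr}(CNRS(\mathcal{G}))/N$.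 Then $LE_{CN}(\mathcal{G}) = \sum_{\alpha} |\alpha - \Delta(\mathcal{G})|$ over all eigenvalues $\alpha$ of $CNL(\mathcal{G})$ with multiplicity, and $LE^+_{CN}(\mathcal{G}) = \sum_{\beta} |\beta - \Delta(\mathcal{G})|$ over all eigenvalues $\beta$ of $CNSL(\mathcal{G})$ with multiplicity. *)

theory Defs
  imports
    "HOL-Algebra.Coset"
    "Graph_Theory.Pair_Digraph"
    "Jordan_Normal_Form.Spectral_Radius"
begin

section \<open>Groups\<close>

definition group_center :: "('a, 'b) monoid_scheme \<Rightarrow> 'a set" where
  "group_center G = {z \<in> carrier G. \<forall>g\<in>carrier G. z \<otimes>\<^bsub>G\<^esub> g = g \<otimes>\<^bsub>G\<^esub> z}"

definition conj_class :: "('a, 'b) monoid_scheme \<Rightarrow> 'a \<Rightarrow> 'a set" where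
  "conj_class G x = (\<lambda>g. g \<otimes>\<^bsub>G\<^esub> x \<otimes>\<^bsub>G\<^esub> inv\<^bsub>G\<^esub> g) ` carrier G"

text \<open>
  The dihedral group of order \<open>2 * n\<close>. With \<open>r\<close> the rotation and \<open>s\<close> the reflection, the pair
  \<open>(i, False)\<close> stands for \<open>r ^ i\<close> and \<open>(i, True)\<close> for \<open>r ^ i * s\<close>, and
  multiplication follows from \<open>s * r ^ j = r ^ (- j) * s\<close>.
\<close>

definition dihedral_group :: "nat \<Rightarrow> (int \<times> bool) monoid" where
  "dihedral_group n =
     \<lparr>carrier = {0..<int n} \<times> UNIV,
      monoid.mult = (\<lambda>(i, a) (j, b). ((if a then i - j else i + j) mod int n, a \<noteq> b)),
      one = (0, False)\<rparr>"

lemma group_dihedral_group: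
  assumes "n > 0"
  shows "group (dihedral_group n)"
proof (rule groupI)
  fix x y z
  assume "x \<in> carrier (dihedral_group n)" "y \<in> carrier (dihedral_group n)"
    "z \<in> carrier (dihedral_group n)"
  show "x \<otimes>\<^bsub>dihedral_group n\<^esub> y \<otimes>\<^bsub>dihedral_group n\<^esub> z =
        x \<otimes>\<^bsub>dihedral_group n\<^esub> (y \<otimes>\<^bsub>dihedral_group n\<^esub> z)"
    by (auto simp: dihedral_group_def mod_simps algebra_simps split: prod.splits)
next
  fix x assume x: "x \<in> carrier (dihedral_group n)"
  define y where "y = (if snd x then x else ((- fst x) mod int n, False))"
  have "y \<in> carrier (dihedral_group n)"
    using x assms by (auto simp: y_def dihedral_group_def)
  moreover have "y \<otimes>\<^bsub>dihedral_group n\<^esub> x = \<one>\<^bsub>dihedral_group n\<^esub>"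
    using x by (auto simp: y_def dihedral_group_def mod_simps split: prod.splits)
  ultimately show "\<exists>y\<in>carrier (dihedral_group n).
      y \<otimes>\<^bsub>dihedral_group n\<^esub> x = \<one>\<^bsub>dihedral_group n\<^esub>" ..
qed (use assms in \<open>auto simp: dihedral_group_def split: prod.splits\<close>)

lemma order_dihedral_group: "Coset.order (dihedral_group n) = 2 * n"
  by (simp add: Coset.order_def dihedral_group_def card_cartesian_product)


section \<open>The commuting conjugacy class graph\<close>

text \<open>
  An undirected graph is encoded by its symmetric set of arcs, so a finite simple graph is
  an instance of the locale \<open>pair_graph\<close>.
\<close>

definition ccc_graph :: "('a, 'b) monoid_scheme \<Rightarrow> 'a set pair_pre_digraph" where
  "ccc_graph G =
     \<lparr>pverts = conj_class G ` (carrier G - group_center G),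
      parcs = {(X, Y). X \<in> conj_class G ` (carrier G - group_center G) \<and>
                       Y \<in> conj_class G ` (carrier G - group_center G) \<and> X \<noteq> Y \<and>
                       (\<exists>x\<in>X. \<exists>y\<in>Y. x \<otimes>\<^bsub>G\<^esub> y = y \<otimes>\<^bsub>G\<^esub> x)}\<rparr>"

lemma pair_graph_ccc_graph:
  assumes "finite (carrier G)"
  shows "pair_graph (ccc_graph G)"
proof
  have fin: "finite (pverts (ccc_graph G))"
    using assms by (simp add: ccc_graph_def)
  then show "finite (pverts (ccc_graph G))" .
  have "parcs (ccc_graph G) \<subseteq> pverts (ccc_graph G) \<times> pverts (ccc_graph G)"
    by (auto simp: ccc_graph_def)
  then show "finite (parcs (ccc_graph G))"
    using fin by (meson finite_SigmaI finite_subset)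
  have "sym (parcs (ccc_graph G))"
    by (rule symI) (simp add: ccc_graph_def, metis)
  moreover have "arcs_ends (with_proj (ccc_graph G)) = parcs (ccc_graph G)"
    by (auto simp: arcs_ends_def arc_to_ends_def)
  ultimately show "symmetric (with_proj (ccc_graph G))"
    by (simp add: symmetric_def)
qed (auto simp: ccc_graph_def)


section \<open>Common neighbourhood energies\<close>

text \<open>
  The matrices are indexed by \<open>0, \<dots>, N - 1\<close>, which requires numbering the vertices. The numbering
  is arbitrary; another one conjugates all matrices by a permutation matrix and therefore
  changes none of the energies.
\<close>

definition vertex_list :: "'a pair_pre_digraph \<Rightarrow> 'a list" where
  "vertex_list \<Gamma> = (SOME vs. distinct vs \<and> set vs = pverts \<Gamma>)"

definition common_neighbours :: "'a pair_pre_digraph \<Rightarrow> 'a \<Rightarrow> 'a \<Rightarrow> 'a set" where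
  "common_neighbours \<Gamma> u v =
     {w \<in> pverts \<Gamma>. w \<noteq> u \<and> w \<noteq> v \<and> (u, w) \<in> parcs \<Gamma> \<and> (v, w) \<in> parcs \<Gamma>}"

definition CN :: "'a pair_pre_digraph \<Rightarrow> real mat" where
  "CN \<Gamma> = mat (card (pverts \<Gamma>)) (card (pverts \<Gamma>))
     (\<lambda>(i, j). if i = j then 0
               else real (card (common_neighbours \<Gamma> (vertex_list \<Gamma> ! i) (vertex_list \<Gamma> ! j))))"

definition CNRS :: "'a pair_pre_digraph \<Rightarrow> real mat" where
  "CNRS \<Gamma> = mat_diag (card (pverts \<Gamma>)) (\<lambda>i. \<Sum>j<card (pverts \<Gamma>). CN \<Gamma> $$ (i, j))"

definition CNL :: "'a pair_pre_digraph \<Rightarrow> real mat" where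
  "CNL \<Gamma> = CNRS \<Gamma> - CN \<Gamma>"

definition CNSL :: "'a pair_pre_digraph \<Rightarrow> real mat" where
  "CNSL \<Gamma> = CNRS \<Gamma> + CN \<Gamma>"

definition CN_mean :: "'a pair_pre_digraph \<Rightarrow> real" where
  "CN_mean \<Gamma> = (\<Sum>i<card (pverts \<Gamma>). CNRS \<Gamma> $$ (i, i)) / real (card (pverts \<Gamma>))"

text \<open>
  The sum of \<open>\<bar>\<alpha> - c\<bar>\<close> over all eigenvalues \<open>\<alpha>\<close> of \<open>A\<close>, each repeated according to its
  multiplicity as a root of the characteristic polynomial. Eigenvalues are taken in the
  complex numbers, so that none can be lost.
\<close>

definition eigenvalue_deviation :: "real mat \<Rightarrow> real \<Rightarrow> real" where
  "eigenvalue_deviation A c =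
     (let B = map_mat complex_of_real A
      in \<Sum>\<alpha>\<in>spectrum B. real (Polynomial.order \<alpha> (char_poly B)) * cmod (\<alpha> - complex_of_real c))"

definition E_CN :: "'a pair_pre_digraph \<Rightarrow> real" where
  "E_CN \<Gamma> = eigenvalue_deviation (CN \<Gamma>) 0"

definition LE_CN :: "'a pair_pre_digraph \<Rightarrow> real" where
  "LE_CN \<Gamma> = eigenvalue_deviation (CNL \<Gamma>) (CN_mean \<Gamma>)"

definition LE_plus_CN :: "'a pair_pre_digraph \<Rightarrow> real" where
  "LE_plus_CN \<Gamma> = eigenvalue_deviation (CNSL \<Gamma>) (CN_mean \<Gamma>)"

end

theory Submission
  imports Defs
begin

text \<open>
  Let \<open>z = |Z(G)|\<close>. The preimage \<open>H\<close> of the rotations is abelian, and an element outside \<open>H\<close>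
  commutes with an element of \<open>H\<close> only if the latter is central. Hence non-central classes in \<open>H\<close>
  have size \<open>2\<close> and form a clique on \<open>a = (n - 1) z / 2\<close> vertices, while classes outside \<open>H\<close> have
  size \<open>n\<close> and form \<open>K\<^sub>z\<close> for odd \<open>n\<close> and \<open>2 K\<^sub>b\<close> with \<open>b = z / 2\<close> for even \<open>n\<close>. A clique
  \<open>K\<^sub>m\<close> contributes to the spectra of \<open>CN\<close>, \<open>CNL\<close>, \<open>CNSL\<close> the values
  \<open>(m - 1) (m - 2)\<close>, \<open>0\<close>, \<open>2 (m - 1) (m - 2)\<close> once and
  \<open>- (m - 2)\<close>, \<open>m (m - 2)\<close>, \<open>(m - 2)\<^sup>2\<close> with multiplicity \<open>m - 1\<close>.
  The deviations from the mean sum to \<open>0\<close>, so each energy is twice the sum of the positive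
  deviations, and only the eigenvalues from \<open>K\<^sub>a\<close> matter for the Laplacian ones.
\<close>

section \<open>The spectrum of a block matrix\<close>

lemma mat_mult_index:
  assumes "A \<in> carrier_mat n n" "B \<in> carrier_mat n n" "i < n" "j < n"
  shows "(A * B) $$ (i, j) = (\<Sum>k<n. A $$ (i, k) * B $$ (k, j))"
  using assms by (auto simp: scalar_prod_def atLeast0LessThan intro!: sum.cong)

text \<open>
  \<open>r i\<close> is the largest index in the block of \<open>i\<close>. Subtracting the basis vector of \<open>r i\<close> from that of
  every other \<open>i\<close> in the block makes the matrix upper triangular, whatever the order of the indices.
\<close>

lemma char_poly_block_matrix:
  fixes d e :: "nat \<Rightarrow> 'a::field" and r :: "nat \<Rightarrow> nat"
  assumes r: "\<And>i. i < n \<Longrightarrow> r i < n" "\<And>i. i < n \<Longrightarrow> r (r i) = r i" "\<And>i. i < n \<Longrightarrow> i \<le> r i"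
  shows "char_poly (mat n n (\<lambda>(i, j). (if i = j then d (r i) else 0) + (if r i = r j then e (r i) else 0)))
    = (\<Prod>i<n. [:- (d (r i) + (if r i = i then e i * of_nat (card {j. j < n \<and> r j = i}) else 0)), 1:])"
proof -
  define M where "M = mat n n (\<lambda>(i, j). (if i = j then d (r i) else 0) + (if r i = r j then e (r i) else 0))"
  define S where "S = mat n n (\<lambda>(i, j). (if i = j then 1 else 0) - (if r j = i \<and> j \<noteq> i then 1 else 0 :: 'a))"
  define S' where "S' = mat n n (\<lambda>(i, j). (if i = j then 1 else 0) + (if r j = i \<and> j \<noteq> i then 1 else 0 :: 'a))"
  define m where "m j = (of_nat (card {k. k < n \<and> r k = j}) :: 'a)" for j
  \<comment> \<open>For a representative \<open>j\<close>, the block part of \<open>M\<close> sends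
    its basis vector to \<open>e j\<close> times the block sum, which equals the sum of the
    differences plus \<open>m j\<close> times that vector. The block part kills the differences, so
    their columns keep only \<open>d\<close>.\<close>
  define T where "T = mat n n (\<lambda>(i, j). if i = j then d (r i) + (if r i = i then e i * m i else 0)
      else if r i = j then e j else 0)"
  have carr: "M \<in> carrier_mat n n" "S \<in> carrier_mat n n" "S' \<in> carrier_mat n n" "T \<in> carrier_mat n n"
    by (auto simp: M_def S_def S'_def T_def)
  have "S * S' = 1\<^sub>m n"
  proof (rule eq_matI)
    fix i j assume "i < dim_row (1\<^sub>m n :: 'a mat)" "j < dim_col (1\<^sub>m n :: 'a mat)"
    then have ij: "i < n" "j < n" by auto
    have "(S * S') $$ (i, j) = (\<Sum>k<n. (if k = j then S $$ (i, k) else 0)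
        + (if k = r j then (if r j = j then 0 else S $$ (i, k)) else 0))"
      using ij unfolding mat_mult_index[OF carr(2,3) ij]
      by (intro sum.cong) (auto simp: S'_def)
    also have "\<dots> = S $$ (i, j) + (if r j = j then 0 else S $$ (i, r j))"
      using ij r(1)[OF ij(2)] by (simp add: sum.distrib sum.delta)
    also have "\<dots> = 1\<^sub>m n $$ (i, j)"
      using ij r(1,2)[OF ij(2)] by (auto simp: S_def)
    finally show "(S * S') $$ (i, j) = 1\<^sub>m n $$ (i, j)" .
  qed (auto simp: S_def S'_def)
  moreover from this have "S' * S = 1\<^sub>m n"
    by (rule mat_mult_left_right_inverse[OF carr(2,3)])
  moreover have "M * S = S * T"
  proof (rule eq_matI)
    fix i j assume "i < dim_row (S * T)" "j < dim_col (S * T)"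
    then have ij: "i < n" "j < n" by (auto simp: S_def T_def)
    have "(M * S) $$ (i, j) = (\<Sum>k<n. (if k = j then M $$ (i, k) else 0)
        - (if k = r j then (if r j = j then 0 else M $$ (i, k)) else 0))"
      using ij unfolding mat_mult_index[OF carr(1,2) ij]
      by (intro sum.cong) (auto simp: S_def)
    also have "\<dots> = M $$ (i, j) - (if r j = j then 0 else M $$ (i, r j))"
      using ij r(1)[OF ij(2)] by (simp add: sum_subtractf sum.delta)
    finally have MS: "(M * S) $$ (i, j) = M $$ (i, j) - (if r j = j then 0 else M $$ (i, r j))" .
    have row: "(\<Sum>k | k < n \<and> r k = j. S $$ (i, k)) = (if r i = j then 1 else 0) - (if i = j then m j - 1 else 0)"
      if "r j = j"
    proof -
      \<comment> \<open>Within its block, row \<open>j\<close> of \<open>S\<close> is 1 at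
        \<open>j\<close> and -1 elsewhere; writing 1 as 2 - 1 turns it into a constant with a single
        correction.\<close>
      have "(\<Sum>k | k < n \<and> r k = j. S $$ (i, k))
          = (\<Sum>k | k < n \<and> r k = j. (if k = i then (if i = j then 2 else 1) else 0) - (if i = j then 1 else 0))"
        using ij by (intro sum.cong) (auto simp: S_def)
      also have "\<dots> = (if r i = j then 1 else 0) - (if i = j then m j - 1 else 0)"
        using ij that by (auto simp: sum_subtractf sum.delta m_def)
      finally show ?thesis .
    qed
    have "(S * T) $$ (i, j) = M $$ (i, j) - (if r j = j then 0 else M $$ (i, r j))"
    proof (cases "r j = j")
      case True
      \<comment> \<open>Column \<open>j\<close> of \<open>T\<close> is read as \<open>e j\<close> on
        the whole block, with a correction at the diagonal.\<close>
      have "(S * T) $$ (i, j) = (\<Sum>k<n. (if k = j then S $$ (i, k) * (d j + e j * m j - e j) else 0)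
          + e j * (if r k = j then S $$ (i, k) else 0))"
        using ij True unfolding mat_mult_index[OF carr(2,4) ij]
        by (intro sum.cong) (auto simp: T_def algebra_simps)
      also have "\<dots> = S $$ (i, j) * (d j + e j * m j - e j) + e j * (\<Sum>k | k < n \<and> r k = j. S $$ (i, k))"
        using ij by (simp add: sum.distrib sum_distrib_left[symmetric] sum.delta sum.If_cases
            Int_def conj_commute)
      also have "\<dots> = M $$ (i, j)"
        unfolding row[OF True] using ij True by (auto simp: M_def S_def algebra_simps)
      finally show ?thesis using True by simp
    next
      case False
      have "(S * T) $$ (i, j) = (\<Sum>k<n. (if k = j then S $$ (i, k) * d (r j) else 0))"
        using ij False r(2) unfolding mat_mult_index[OF carr(2,4) ij]
        by (intro sum.cong) (auto simp: T_def)
      also have "\<dots> = S $$ (i, j) * d (r j)"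
        using ij by simp
      also have "\<dots> = M $$ (i, j) - M $$ (i, r j)"
        using ij r(1,2)[OF ij(2)] False by (auto simp: M_def S_def)
      finally show ?thesis using False by simp
    qed
    with MS show "(M * S) $$ (i, j) = (S * T) $$ (i, j)" by simp
  qed (auto simp: M_def S_def T_def)
  ultimately have "M = S * T * S'"
    using carr by (metis assoc_mult_mat right_mult_one_mat)
  then have "similar_mat M T"
    using carr \<open>S * S' = 1\<^sub>m n\<close> \<open>S' * S = 1\<^sub>m n\<close> by (intro similar_matI[of _ _ S S' n]) auto
  then have "char_poly M = char_poly T"
    by (rule char_poly_similar)
  also have "\<dots> = (\<Prod>a\<leftarrow>diag_mat T. [:- a, 1:])"
    using r(3) by (intro char_poly_upper_triangular[OF carr(4)]) (fastforce simp: upper_triangular_def T_def)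
  also have "\<dots> = (\<Prod>i<n. [:- (T $$ (i, i)), 1:])"
    using carr(4) by (simp add: diag_mat_def interv_sum_list_conv_sum_set_nat comp_def
        prod.distinct_set_conv_list[symmetric] atLeast0LessThan)
  also have "\<dots> = (\<Prod>i<n. [:- (d (r i) + (if r i = i then e i * m i else 0)), 1:])"
    by (intro prod.cong) (auto simp: T_def)
  finally show ?thesis unfolding M_def m_def .
qed

text \<open>Over the complex numbers the order of a root counts the indices with that value of
  \<open>f\<close>. Grouping the indices by value therefore gives each eigenvalue its
  multiplicity.\<close>

lemma eigenvalue_deviation_split:
  assumes A: "A \<in> carrier_mat n n" and cp: "char_poly A = (\<Prod>i<n. [:- f i, 1:])"
  shows "eigenvalue_deviation A c = (\<Sum>i<n. \<bar>f i - c\<bar>)"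
proof -
  define B where "B = map_mat complex_of_real A"
  define g where "g i = complex_of_real (f i)" for i
  have B: "B \<in> carrier_mat n n" using A by (simp add: B_def)
  interpret of_real_poly_hom: map_poly_comm_ring_hom complex_of_real ..
  have cpB: "char_poly B = (\<Prod>i<n. [:- g i, 1:])"
    unfolding B_def of_real_hom.char_poly_hom[OF A] cp of_real_poly_hom.hom_prod
    by (simp add: g_def)
  have spec: "spectrum B = g ` {..<n}"
    by (auto simp: spectrum_def eigenvalue_root_char_poly[OF B] cpB poly_prod)
  have ord: "Polynomial.order \<alpha> (char_poly B) = card {i \<in> {..<n}. g i = \<alpha>}" for \<alpha>
  proof -
    have "Polynomial.order \<alpha> (\<Prod>i\<in>I. [:- g i, 1:]) = card {i \<in> I. g i = \<alpha>}" if "finite I" for I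
      using that
    proof (induction I rule: finite_induct)
      case (insert i I)
      have "(\<Prod>i\<in>I. [:- g i, 1:]) \<noteq> 0" using insert by auto
      moreover have "{j \<in> insert i I. g j = \<alpha>} = (if g i = \<alpha> then insert i {j \<in> I. g j = \<alpha>} else {j \<in> I. g j = \<alpha>})"
        by auto
      ultimately show ?case
        using insert by (simp add: order_mult order_linear' del: mult_pCons_left)
    qed auto
    then show ?thesis by (simp add: cpB)
  qed
  have "eigenvalue_deviation A c = (\<Sum>\<alpha>\<in>g ` {..<n}. \<Sum>i | i \<in> {..<n} \<and> g i = \<alpha>. cmod (g i - of_real c))"
    by (auto simp: eigenvalue_deviation_def Let_def B_def[symmetric] spec ord intro!: sum.cong)
  also have "\<dots> = (\<Sum>i<n. cmod (g i - of_real c))"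
    by (rule sum.image_gen[symmetric]) simp
  also have "\<dots> = (\<Sum>i<n. \<bar>f i - c\<bar>)"
    unfolding g_def of_real_diff[symmetric] norm_of_real ..
  finally show ?thesis .
qed

section \<open>Energies of disjoint unions of cliques\<close>

text \<open>A disjoint union of complete graphs, one for each value that \<kappa> takes on the
  vertices.\<close>

locale clique_union =
  fixes \<Gamma> :: "'v pair_pre_digraph" and \<kappa> :: "'v \<Rightarrow> 'c"
  assumes finite_verts: "finite (pverts \<Gamma>)"
    and arcs_iff: "(u, v) \<in> parcs \<Gamma> \<longleftrightarrow> u \<in> pverts \<Gamma> \<and> v \<in> pverts \<Gamma> \<and> u \<noteq> v \<and> \<kappa> u = \<kappa> v"
begin

abbreviation nverts where "nverts \<equiv> card (pverts \<Gamma>)"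

abbreviation vertex where "vertex i \<equiv> vertex_list \<Gamma> ! i"

definition block :: "'c \<Rightarrow> 'v set" where
  "block b = {v \<in> pverts \<Gamma>. \<kappa> v = b}"

text \<open>Real-valued because \<open>block_size b - 2\<close> is -1 for an isolated
  vertex.\<close>

definition block_size :: "'c \<Rightarrow> real" where
  "block_size b = real (card (block b))"

lemma vertex_list: "distinct (vertex_list \<Gamma>)" "set (vertex_list \<Gamma>) = pverts \<Gamma>"
  "length (vertex_list \<Gamma>) = nverts"
proof -
  have "\<exists>vs. distinct vs \<and> set vs = pverts \<Gamma>"
    using finite_distinct_list[OF finite_verts] by blast
  from someI_ex[OF this] show *: "distinct (vertex_list \<Gamma>)" "set (vertex_list \<Gamma>) = pverts \<Gamma>"
    unfolding vertex_list_def by blast+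
  show "length (vertex_list \<Gamma>) = nverts"
    using distinct_card[OF *(1)] *(2) by simp
qed

lemma bij_betw_vertex: "bij_betw vertex {..<nverts} (pverts \<Gamma>)"
  using bij_betw_nth[OF vertex_list(1) refl refl] vertex_list(2,3) by simp

lemma card_indices: "card {i. i < nverts \<and> \<kappa> (vertex i) = b} = card (block b)"
proof -
  have "vertex ` {i. i < nverts \<and> \<kappa> (vertex i) = b} = block b"
    using bij_betw_vertex by (force simp: block_def bij_betw_def)
  moreover have "inj_on vertex {i. i < nverts \<and> \<kappa> (vertex i) = b}"
    using bij_betw_vertex by (auto simp: bij_betw_def intro: inj_on_subset)
  ultimately show ?thesis
    by (metis card_image)
qed

lemma vertex_in [simp]: "i < nverts \<Longrightarrow> vertex i \<in> pverts \<Gamma>"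
  using bij_betw_vertex by (auto simp: bij_betw_def)

lemma vertex_eq_iff [simp]: "i < nverts \<Longrightarrow> j < nverts \<Longrightarrow> vertex i = vertex j \<longleftrightarrow> i = j"
  using bij_betw_vertex by (auto simp: bij_betw_def inj_on_def)

lemma image_label_vertex: "(\<lambda>i. \<kappa> (vertex i)) ` {..<nverts} = \<kappa> ` pverts \<Gamma>"
  using bij_betw_vertex by (metis bij_betw_def image_image)

lemma sum_vertices: "(\<Sum>i<nverts. g (\<kappa> (vertex i))) = (\<Sum>b\<in>\<kappa> ` pverts \<Gamma>. block_size b * g b)"
proof -
  have "(\<Sum>i<nverts. g (\<kappa> (vertex i))) =
      (\<Sum>b\<in>\<kappa> ` pverts \<Gamma>. \<Sum>i | i \<in> {..<nverts} \<and> \<kappa> (vertex i) = b. g (\<kappa> (vertex i)))"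
    unfolding image_label_vertex[symmetric] by (rule sum.image_gen) simp
  also have "\<dots> = (\<Sum>b\<in>\<kappa> ` pverts \<Gamma>. block_size b * g b)"
    by (intro sum.cong) (auto simp: block_size_def card_indices)
  finally show ?thesis .
qed

text \<open>On a block of size m the matrix is d I + e J with J the all-ones matrix. Its eigenvalues
  are d + e m once, on the constant vector, and d with multiplicity m - 1.\<close>

lemma eigenvalue_deviation_block_matrix:
  fixes d e :: "'c \<Rightarrow> real"
  assumes A: "A = mat nverts nverts (\<lambda>(i, j). (if i = j then d (\<kappa> (vertex i)) else 0)
    + (if \<kappa> (vertex i) = \<kappa> (vertex j) then e (\<kappa> (vertex i)) else 0))"
  shows "eigenvalue_deviation A c =
    (\<Sum>b\<in>\<kappa> ` pverts \<Gamma>. \<bar>d b + e b * block_size b - c\<bar> + (block_size b - 1) * \<bar>d b - c\<bar>)"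
proof -
  define I where "I b = {i. i < nverts \<and> \<kappa> (vertex i) = b}" for b
  \<comment> \<open>The vertex numbering is arbitrary, so blocks need not be intervals; taking the
    maximum ensures \<open>i \<le> r i\<close>.\<close>
  define r where "r i = Max (I (\<kappa> (vertex i)))" for i
  have finI: "finite (I b)" for b by (simp add: I_def)
  have r: "r i < nverts" "\<kappa> (vertex (r i)) = \<kappa> (vertex i)" "i \<le> r i" if "i < nverts" for i
  proof -
    have "i \<in> I (\<kappa> (vertex i))" using that by (simp add: I_def)
    then have "r i \<in> I (\<kappa> (vertex i))"
      unfolding r_def using finI by (intro Max_in) auto
    then show "r i < nverts" "\<kappa> (vertex (r i)) = \<kappa> (vertex i)" by (auto simp: I_def)
    show "i \<le> r i" unfolding r_def using \<open>i \<in> I _\<close> finI by (intro Max_ge)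
  qed
  have rr: "r (r i) = r i" if "i < nverts" for i
    using r(2)[OF that] by (simp add: r_def)
  have r_eq: "r i = r j \<longleftrightarrow> \<kappa> (vertex i) = \<kappa> (vertex j)" if "i < nverts" "j < nverts" for i j
    using r(2)[OF that(1)] r(2)[OF that(2)] by (metis r_def)
  \<comment> \<open>The exceptional eigenvalue of each block is assigned to its representative, the
    ordinary one to all other indices.\<close>
  define f where "f i = d (\<kappa> (vertex i)) + (if r i = i then e (\<kappa> (vertex i)) * block_size (\<kappa> (vertex i)) else 0)" for i
  have "A = mat nverts nverts (\<lambda>(i, j). (if i = j then d (\<kappa> (vertex (r i))) else 0)
      + (if r i = r j then e (\<kappa> (vertex (r i))) else 0))"
    unfolding A by (rule eq_matI) (auto simp: r r_eq)
  then have "char_poly A = (\<Prod>i<nverts. [:- (d (\<kappa> (vertex (r i)))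
      + (if r i = i then e (\<kappa> (vertex i)) * of_nat (card {j. j < nverts \<and> r j = i}) else 0)), 1:])"
    using char_poly_block_matrix[OF r(1) rr r(3), of "\<lambda>i. d (\<kappa> (vertex i))" "\<lambda>i. e (\<kappa> (vertex i))"]
    by simp
  also have "\<dots> = (\<Prod>i<nverts. [:- f i, 1:])"
  proof (intro prod.cong refl)
    fix i assume "i \<in> {..<nverts}"
    then have i: "i < nverts" by simp
    have "{j. j < nverts \<and> r j = i} = {j. j < nverts \<and> \<kappa> (vertex j) = \<kappa> (vertex i)}" if "r i = i"
      using r_eq[of _ i] i that by auto
    then show "[:- (d (\<kappa> (vertex (r i))) + (if r i = i
        then e (\<kappa> (vertex i)) * of_nat (card {j. j < nverts \<and> r j = i}) else 0)), 1:] = [:- f i, 1:]"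
      using i by (simp add: f_def r block_size_def card_indices)
  qed
  finally have "eigenvalue_deviation A c = (\<Sum>i<nverts. \<bar>f i - c\<bar>)"
    using A by (intro eigenvalue_deviation_split) auto
  also have "\<dots> = (\<Sum>b\<in>\<kappa> ` pverts \<Gamma>. \<Sum>i | i \<in> {..<nverts} \<and> \<kappa> (vertex i) = b. \<bar>f i - c\<bar>)"
    unfolding image_label_vertex[symmetric] by (rule sum.image_gen) simp
  also have "\<dots> = (\<Sum>b\<in>\<kappa> ` pverts \<Gamma>. \<bar>d b + e b * block_size b - c\<bar> + (block_size b - 1) * \<bar>d b - c\<bar>)"
  proof (intro sum.cong refl)
    fix b assume "b \<in> \<kappa> ` pverts \<Gamma>"
    then obtain i where i: "i < nverts" "\<kappa> (vertex i) = b"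
      using image_label_vertex by (metis (no_types, lifting) imageE lessThan_iff)
    define k where "k = r i"
    have k: "k \<in> I b" "r k = k" using r[OF i(1)] rr[OF i(1)] i by (auto simp: k_def I_def)
    have "(\<Sum>j | j \<in> {..<nverts} \<and> \<kappa> (vertex j) = b. \<bar>f j - c\<bar>) = (\<Sum>j\<in>I b. \<bar>f j - c\<bar>)"
      by (simp add: I_def)
    also have "\<dots> = \<bar>f k - c\<bar> + (\<Sum>j\<in>I b - {k}. \<bar>f j - c\<bar>)"
      using k finI by (intro sum.remove) auto
    also have "\<bar>f k - c\<bar> = \<bar>d b + e b * block_size b - c\<bar>"
      using k by (simp add: f_def I_def)
    also have "(\<Sum>j\<in>I b - {k}. \<bar>f j - c\<bar>) = (\<Sum>j\<in>I b - {k}. \<bar>d b - c\<bar>)"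
    proof (intro sum.cong refl)
      fix j assume j: "j \<in> I b - {k}"
      then have "r j = k" using k r_eq[of j k] by (auto simp: I_def)
      with j show "\<bar>f j - c\<bar> = \<bar>d b - c\<bar>" by (auto simp: f_def I_def)
    qed
    also have "\<dots> = (block_size b - 1) * \<bar>d b - c\<bar>"
      using k finI[of b] card_indices[of b] card_gt_0_iff[of "I b"]
      by (auto simp: block_size_def I_def[symmetric] of_nat_diff)
    finally show "(\<Sum>j | j \<in> {..<nverts} \<and> \<kappa> (vertex j) = b. \<bar>f j - c\<bar>)
      = \<bar>d b + e b * block_size b - c\<bar> + (block_size b - 1) * \<bar>d b - c\<bar>" .
  qed
  finally show ?thesis .
qed

section \<open>The common neighbourhood matrices of a union of cliques and their energies\<close>

lemma block_size_ge_1: "b \<in> \<kappa> ` pverts \<Gamma> \<Longrightarrow> block_size b \<ge> 1"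
  using finite_verts by (auto simp: block_size_def block_def Suc_le_eq card_gt_0_iff)

text \<open>Two distinct vertices of a clique of size m have the other m - 2 vertices as common
  neighbours, so the block is (m - 2) (J - I). The diagonal term 2 - m cancels the diagonal of the J
  part.\<close>

lemma CN_eq:
  "CN \<Gamma> = mat nverts nverts (\<lambda>(i, j). (if i = j then 2 - block_size (\<kappa> (vertex i)) else 0)
    + (if \<kappa> (vertex i) = \<kappa> (vertex j) then block_size (\<kappa> (vertex i)) - 2 else 0))"
  unfolding CN_def
proof (rule eq_matI, goal_cases)
  case (1 i j)
  then have ij: "i < nverts" "j < nverts" by auto
  have "real (card (common_neighbours \<Gamma> (vertex i) (vertex j))) =
      (if \<kappa> (vertex i) = \<kappa> (vertex j) then block_size (\<kappa> (vertex i)) - 2 else 0)" if "i \<noteq> j"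
  proof (cases "\<kappa> (vertex i) = \<kappa> (vertex j)")
    case True
    let ?B = "block (\<kappa> (vertex i))"
    have "common_neighbours \<Gamma> (vertex i) (vertex j) = ?B - {vertex i, vertex j}"
      using ij True by (auto simp: common_neighbours_def arcs_iff block_def)
    moreover have sub: "{vertex i, vertex j} \<subseteq> ?B" "finite ?B"
      using ij True finite_verts by (auto simp: block_def)
    moreover have "card {vertex i, vertex j} = 2"
      using ij that by simp
    ultimately show ?thesis
      using True card_mono[OF sub(2,1)] by (simp add: card_Diff_subset block_size_def of_nat_diff)
  next
    case False
    then have "common_neighbours \<Gamma> (vertex i) (vertex j) = {}"
      by (auto simp: common_neighbours_def arcs_iff)
    with False show ?thesis by simp
  qed
  with ij show ?case by auto
qed auto

text \<open>A row has m - 1 off-diagonal entries m - 2 in its block; the proof sums the full block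
  and subtracts the diagonal.\<close>

lemma CNRS_eq:
  "CNRS \<Gamma> = mat_diag nverts (\<lambda>i. (block_size (\<kappa> (vertex i)) - 1) * (block_size (\<kappa> (vertex i)) - 2))"
proof -
  have "(\<Sum>j<nverts. CN \<Gamma> $$ (i, j)) = (block_size (\<kappa> (vertex i)) - 1) * (block_size (\<kappa> (vertex i)) - 2)"
    if i: "i < nverts" for i
  proof -
    have "(\<Sum>j<nverts. CN \<Gamma> $$ (i, j)) = (\<Sum>j<nverts. (if j = i then 2 - block_size (\<kappa> (vertex i)) else 0))
        + (\<Sum>j<nverts. if \<kappa> (vertex j) = \<kappa> (vertex i) then block_size (\<kappa> (vertex i)) - 2 else 0)"
      using i by (auto simp: CN_eq sum.distrib[symmetric] intro!: sum.cong)
    also have "(\<Sum>j<nverts. if \<kappa> (vertex j) = \<kappa> (vertex i) then block_size (\<kappa> (vertex i)) - 2 else 0)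
        = block_size (\<kappa> (vertex i)) * (block_size (\<kappa> (vertex i)) - 2)"
      by (simp add: sum.If_cases Int_def card_indices block_size_def)
    finally show ?thesis using i by (simp add: algebra_simps)
  qed
  then show ?thesis
    unfolding CNRS_def mat_diag_def by (intro eq_matI) auto
qed

lemma card_pverts_eq_sum: "real nverts = (\<Sum>b\<in>\<kappa> ` pverts \<Gamma>. block_size b)"
  using sum_vertices[of "\<lambda>_. 1"] by simp

lemma CN_mean_eq:
  "CN_mean \<Gamma> = (\<Sum>b\<in>\<kappa> ` pverts \<Gamma>. block_size b * ((block_size b - 1) * (block_size b - 2))) / (\<Sum>b\<in>\<kappa> ` pverts \<Gamma>. block_size b)"
proof -
  have "(\<Sum>i<nverts. CNRS \<Gamma> $$ (i, i))
      = (\<Sum>i<nverts. (block_size (\<kappa> (vertex i)) - 1) * (block_size (\<kappa> (vertex i)) - 2))"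
    by (intro sum.cong) (auto simp: CNRS_eq mat_diag_def)
  then show ?thesis
    unfolding CN_mean_def card_pverts_eq_sum
    by (simp add: sum_vertices[of "\<lambda>b. (block_size b - 1) * (block_size b - 2)"])
qed

text \<open>The eigenvalue (m - 1) (m - 2) and the m - 1 copies of 2 - m contribute equally in
  absolute value.\<close>

lemma E_CN_eq: "E_CN \<Gamma> = (\<Sum>b\<in>\<kappa> ` pverts \<Gamma>. 2 * (block_size b - 1) * \<bar>block_size b - 2\<bar>)"
  unfolding E_CN_def eigenvalue_deviation_block_matrix[where d = "\<lambda>b. 2 - block_size b" and e = "\<lambda>b. block_size b - 2", OF CN_eq]
proof (intro sum.cong refl)
  fix b assume "b \<in> \<kappa> ` pverts \<Gamma>"
  then have "block_size b \<ge> 1" by (rule block_size_ge_1)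
  moreover have "2 - block_size b + (block_size b - 2) * block_size b - 0 = (block_size b - 1) * (block_size b - 2)"
    by (simp add: algebra_simps)
  ultimately show "\<bar>2 - block_size b + (block_size b - 2) * block_size b - 0\<bar> + (block_size b - 1) * \<bar>2 - block_size b - 0\<bar>
      = 2 * (block_size b - 1) * \<bar>block_size b - 2\<bar>"
    by (simp add: abs_mult abs_minus_commute)
qed

text \<open>Each block is m (m - 2) I - (m - 2) J. Its constant vector has eigenvalue 0, which
  accounts for the term \<open>\<bar>CN_mean \<Gamma>\<bar>\<close>.\<close>

lemma LE_CN_eq: "LE_CN \<Gamma> = (\<Sum>b\<in>\<kappa> ` pverts \<Gamma>.
    \<bar>CN_mean \<Gamma>\<bar> + (block_size b - 1) * \<bar>block_size b * (block_size b - 2) - CN_mean \<Gamma>\<bar>)"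
proof -
  have "CNL \<Gamma> = mat nverts nverts (\<lambda>(i, j).
      (if i = j then block_size (\<kappa> (vertex i)) * (block_size (\<kappa> (vertex i)) - 2) else 0)
      + (if \<kappa> (vertex i) = \<kappa> (vertex j) then - (block_size (\<kappa> (vertex i)) - 2) else 0))"
    unfolding CNL_def CNRS_eq CN_eq
    by (rule eq_matI) (auto simp: mat_diag_def algebra_simps)
  from eigenvalue_deviation_block_matrix[where d = "\<lambda>b. block_size b * (block_size b - 2)" and e = "\<lambda>b. - (block_size b - 2)", OF this]
  show ?thesis unfolding LE_CN_def by (simp add: algebra_simps)
qed

text \<open>Each block is (m - 2)^2 I + (m - 2) J, and (m - 2)^2 + m (m - 2) = 2 (m - 1) (m -
  2).\<close>

lemma LE_plus_CN_eq: "LE_plus_CN \<Gamma> = (\<Sum>b\<in>\<kappa> ` pverts \<Gamma>.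
    \<bar>2 * (block_size b - 1) * (block_size b - 2) - CN_mean \<Gamma>\<bar> + (block_size b - 1) * \<bar>(block_size b - 2)^2 - CN_mean \<Gamma>\<bar>)"
proof -
  have "CNSL \<Gamma> = mat nverts nverts (\<lambda>(i, j).
      (if i = j then (block_size (\<kappa> (vertex i)) - 2)^2 else 0)
      + (if \<kappa> (vertex i) = \<kappa> (vertex j) then block_size (\<kappa> (vertex i)) - 2 else 0))"
    unfolding CNSL_def CNRS_eq CN_eq
    by (rule eq_matI) (auto simp: mat_diag_def algebra_simps power2_eq_square)
  from eigenvalue_deviation_block_matrix[where d = "\<lambda>b. (block_size b - 2)^2" and e = "\<lambda>b. block_size b - 2", OF this]
  show ?thesis unfolding LE_plus_CN_def by (simp add: algebra_simps power2_eq_square)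
qed

end

text \<open>The strict case as a statement about reals, for one clique of size \<open>a\<close> and
  \<open>t\<close> cliques of size \<open>b\<close>, with ratio \<open>k\<close>. Integrality of
  \<open>b\<close> enters only through the gap between 1 and 2, which makes (b - 1) (b - 2)
  nonnegative.\<close>

lemma clique_energies_less:
  fixes a b k t D :: real
  assumes b: "b = 1 \<or> b \<ge> 2" and a: "a = k * b"
    and k: "t = 1 \<and> k = 2 \<and> b \<ge> 2 \<or> t = 1 \<and> k \<ge> 3 \<or> t = 2 \<and> k \<ge> 3"
    and D: "D = (a * ((a - 1) * (a - 2)) + t * (b * ((b - 1) * (b - 2)))) / (a + t * b)"
    and E: "E = 2 * (a - 1) * \<bar>a - 2\<bar> + t * (2 * (b - 1) * \<bar>b - 2\<bar>)"
    and L: "L = \<bar>D\<bar> + (a - 1) * \<bar>a * (a - 2) - D\<bar> + t * (\<bar>D\<bar> + (b - 1) * \<bar>b * (b - 2) - D\<bar>)"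
    and P: "P = \<bar>2 * (a - 1) * (a - 2) - D\<bar> + (a - 1) * \<bar>(a - 2)^2 - D\<bar>
      + t * (\<bar>2 * (b - 1) * (b - 2) - D\<bar> + (b - 1) * \<bar>(b - 2)^2 - D\<bar>)"
  shows "E < P \<and> P < L"
proof -
  define f h where "f = (a - 1) * (a - 2)" and "h = (b - 1) * (b - 2)"
  have b1: "b \<ge> 1" and t: "t \<ge> 1" and k2: "k \<ge> 2" using b k by auto
  have a3: "a \<ge> 3"
  proof (cases "k \<ge> 3")
    case True
    then show ?thesis using mult_mono[of 3 k 1 b] b1 a by auto
  next
    case False
    then show ?thesis using k a by auto
  qed
  have h0: "h \<ge> 0" using b by (auto simp: h_def)
  have "f > 0" using a3 by (simp add: f_def)
  \<comment> \<open>The key estimate: the row sum \<open>f\<close> of the large clique dominates the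
    row sum \<open>h\<close> of the small ones.\<close>
  have fh: "f > (k + t + 1) * h"
  proof -
    have *: "f - (k + t + 1) * h = (k^2 - k - t - 1) * b^2 + 3 * (t + 1) * b - 2 * k - 2 * t"
      unfolding f_def h_def a by (simp add: algebra_simps power2_eq_square)
    \<comment> \<open>For \<open>t = 1\<close>, \<open>k = 2\<close> the quadratic coefficient
      vanishes and 6 b - 6 remains, so b > 1 is essential. Otherwise all coefficients of positive
      powers of \<open>b\<close> are nonnegative, and b = 1 gives the lower bound k^2 - 3 k +
      2.\<close>
    consider "t = 1" "k = 2" "b \<ge> 2" | "t \<in> {1, 2}" "k \<ge> 3" using k by auto
    then have "(k^2 - k - t - 1) * b^2 + 3 * (t + 1) * b - 2 * k - 2 * t > 0"
    proof cases
      case 2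
      have "k * k \<ge> 3 * k" using 2 by (intro mult_right_mono) auto
      moreover have "t \<le> 2" using 2 by auto
      ultimately have "k^2 - k - t - 1 \<ge> 0" using 2(2) unfolding power2_eq_square by linarith
      then have "(k^2 - k - t - 1) * b^2 \<ge> k^2 - k - t - 1"
        using b1 mult_left_mono[of 1 "b^2" "k^2 - k - t - 1"] by simp
      moreover have "3 * (t + 1) * b \<ge> 3 * t + 3"
        using b1 t mult_left_mono[of 1 b "3 * (t + 1)"] by simp
      ultimately show ?thesis
        using \<open>k * k \<ge> 3 * k\<close> \<open>t \<le> 2\<close> t 2(2) power2_eq_square[of k] by linarith
    qed auto
    with * show ?thesis by linarith
  qed
  \<comment> \<open>The mean \<open>D\<close> weighs \<open>f\<close> and \<open>h\<close> in the
    ratio of the vertex counts, \<open>k\<close> to \<open>t\<close>.\<close>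
  have N: "(k + t) * D = k * f + t * h"
  proof -
    have "D = b * (k * f + t * h) / (b * (k + t))"
      unfolding D f_def h_def a by (simp add: algebra_simps)
    also have "\<dots> = (k * f + t * h) / (k + t)" using b1 by simp
    finally show ?thesis using k2 t by simp
  qed
  \<comment> \<open>The excess of the large row sum over the mean. The multiple eigenvalues of the
    large clique deviate by X + (a - 2) for \<open>L\<close> and by X - (a - 2) for
    \<open>P\<close>.\<close>
  define X where "X = f - D"
  have kX: "(k + t) * X = t * (f - h)"
    unfolding X_def using N by (simp add: algebra_simps)
  have X: "X > t * h"
  proof -
    have "(k + t) * h < f - h" using fh by (simp add: algebra_simps)
    then have "t * (f - h) > t * ((k + t) * h)" using t by simp
    then have "(k + t) * X > (k + t) * (t * h)" unfolding kX by (simp add: algebra_simps)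
    then show ?thesis using k2 t by simp
  qed
  \<comment> \<open>This puts the small cliques' largest eigenvalue in \<open>P\<close> below the
    mean, fixing the sign of their deviations.\<close>
  have hD: "2 * h \<le> D"
  proof -
    have "(k - 1) * (k + t) * h \<ge> 0" using k2 t h0 by simp
    moreover have "k * f \<ge> k * ((k + t + 1) * h)" using fh k2 by simp
    ultimately have "(k + t) * (2 * h) \<le> (k + t) * D" unfolding N by (simp add: algebra_simps)
    then show ?thesis using k2 t by simp
  qed
  have "(k + t) * D > 0" unfolding N using \<open>f > 0\<close> k2 t h0 by (intro add_pos_nonneg) auto
  then have "D > 0" using k2 t by (simp add: zero_less_mult_iff)
  have X0: "X > 0" using X h0 t by (smt (verit) mult_nonneg_nonneg)
  \<comment> \<open>For b = 1 the bound (b - 2)^2 \<le> h fails, but then the factor b - 1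
    vanishes.\<close>
  have bD: "(b - 1) * \<bar>(b - 2)^2 - D\<bar> = (b - 1) * (D - (b - 2)^2)"
  proof (cases "b = 1")
    case False
    then have "b \<ge> 2" using b by auto
    then have "(b - 2)^2 \<le> h" unfolding h_def power2_eq_square by (intro mult_right_mono) auto
    then show ?thesis using hD h0 by simp
  qed simp
  \<comment> \<open>The trace identity by which the deviations sum to zero; it trades the
    contribution of the small cliques for that of the large one.\<close>
  have bal: "a * f + t * (b * h) = (a + t * b) * D"
  proof -
    have "a + t * b > 0" using a3 b1 t by (intro add_pos_pos mult_pos_pos) auto
    then show ?thesis unfolding D f_def h_def by simp
  qed
  have E_eq: "E = 2 * f + 2 * (t * h)"
    using E a3 b by (auto simp: f_def h_def algebra_simps)
  have sq: "(a - 2)^2 - D = X - (a - 2)"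
    by (simp add: X_def f_def algebra_simps power2_eq_square)
  \<comment> \<open>Twice the positive deviations: 2 f - D is f + X, and \<bar>y\<bar> + y is twice
    the positive part of y.\<close>
  have P_eq: "P = 2 * (f + X) + (a - 1) * (\<bar>X - (a - 2)\<bar> + (X - (a - 2)))"
  proof -
    have ff: "2 * (a - 1) * (a - 2) = 2 * f" "2 * (b - 1) * (b - 2) = 2 * h"
      by (simp_all add: f_def h_def)
    have "\<bar>2 * f - D\<bar> = 2 * f - D" "\<bar>2 * h - D\<bar> = D - 2 * h"
      using X0 \<open>f > 0\<close> hD by (auto simp: X_def)
    then have "P = (2 * f - D) + (a - 1) * \<bar>X - (a - 2)\<bar> + t * (D - 2 * h + (b - 1) * (D - (b - 2)^2))"
      unfolding P bD sq ff by simp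
    moreover have "t * (D - 2 * h + (b - 1) * (D - (b - 2)^2)) = t * b * D - t * (b * h)"
      by (simp add: h_def algebra_simps power2_eq_square)
    moreover have "t * b * D - t * (b * h) = a * f - a * D"
      using bal by (simp add: algebra_simps)
    moreover have "a * f - a * D = 2 * f - D + (a - 1) * (X - (a - 2))"
      by (simp add: X_def f_def algebra_simps)
    ultimately show ?thesis by (simp add: X_def algebra_simps)
  qed
  \<comment> \<open>Any choice of signs bounds absolute values from below, so the signs for
    \<open>L\<close> need not be determined.\<close>
  have L_ge: "L \<ge> 2 * ((a - 1) * X + f)"
  proof -
    have "L \<ge> D + (a - 1) * (a * (a - 2) - D) + t * (D + (b - 1) * (D - b * (b - 2)))"
      unfolding L using a3 b1 t by (intro add_mono mult_left_mono) auto
    moreover have "t * (D + (b - 1) * (D - b * (b - 2))) = t * b * D - t * (b * h)"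
      by (simp add: h_def algebra_simps power2_eq_square)
    moreover have "t * b * D - t * (b * h) = a * f - a * D"
      using bal by (simp add: algebra_simps)
    moreover have "D + (a - 1) * (a * (a - 2) - D) + (a * f - a * D) = 2 * ((a - 1) * X + f)"
      by (simp add: X_def f_def algebra_simps)
    ultimately show ?thesis by linarith
  qed
  have "E < P"
  proof -
    have "(a - 1) * (\<bar>X - (a - 2)\<bar> + (X - (a - 2))) \<ge> 0" using a3 by simp
    with X have "2 * f + 2 * (t * h) < 2 * (f + X) + (a - 1) * (\<bar>X - (a - 2)\<bar> + (X - (a - 2)))"
      by (smt (verit))
    then show ?thesis unfolding P_eq E_eq .
  qed
  moreover have "P < L"
  \<comment> \<open>If X \<le> a - 2, the second part of \<open>P\<close> vanishes and a - 1 > 1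
    decides. Otherwise P = 2 a X, and the lower bound for \<open>L\<close> exceeds it by 2 (f - X) =
    2 D.\<close>
  proof (cases "X \<le> a - 2")
    case True
    have "1 * X < (a - 1) * X" using X0 a3 by (intro mult_strict_right_mono) auto
    then show ?thesis using L_ge True unfolding P_eq by simp
  next
    case False
    have "P = 2 * (a * X)"
      using False unfolding P_eq by (simp add: f_def algebra_simps)
    also have "\<dots> < 2 * ((a - 1) * X + f)" using \<open>D > 0\<close> by (simp add: X_def algebra_simps)
    finally show ?thesis using L_ge by linarith
  qed
  ultimately show ?thesis ..
qed

section \<open>Central extensions of dihedral groups\<close>

context group
begin

lemma mult_inv_cancel [simp]:
  assumes "x \<in> carrier G" "y \<in> carrier G"
  shows "x \<otimes> (inv x \<otimes> y) = y" "inv x \<otimes> (x \<otimes> y) = y"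
  using assms by (simp_all flip: m_assoc)

lemma conj_class_self: "x \<in> carrier G \<Longrightarrow> x \<in> conj_class G x"
  by (force simp: conj_class_def intro: image_eqI[of _ _ \<one>])

lemma conj_class_conj:
  assumes "x \<in> carrier G" "g \<in> carrier G"
  shows "conj_class G (g \<otimes> x \<otimes> inv g) = conj_class G x"
proof
  show "conj_class G (g \<otimes> x \<otimes> inv g) \<subseteq> conj_class G x"
  proof
    fix y assume "y \<in> conj_class G (g \<otimes> x \<otimes> inv g)"
    then obtain h where h: "h \<in> carrier G" "y = h \<otimes> (g \<otimes> x \<otimes> inv g) \<otimes> inv h"
      by (auto simp: conj_class_def)
    then have "y = (h \<otimes> g) \<otimes> x \<otimes> inv (h \<otimes> g)"
      using assms by (simp add: m_assoc inv_mult_group)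
    then show "y \<in> conj_class G x" using h assms by (auto simp: conj_class_def)
  qed
  show "conj_class G x \<subseteq> conj_class G (g \<otimes> x \<otimes> inv g)"
  proof
    fix y assume "y \<in> conj_class G x"
    then obtain h where h: "h \<in> carrier G" "y = h \<otimes> x \<otimes> inv h"
      by (auto simp: conj_class_def)
    then have "y = (h \<otimes> inv g) \<otimes> (g \<otimes> x \<otimes> inv g) \<otimes> inv (h \<otimes> inv g)"
      using assms by (simp add: m_assoc inv_mult_group)
    then show "y \<in> conj_class G (g \<otimes> x \<otimes> inv g)" using h assms by (auto simp: conj_class_def)
  qed
qed

lemma conj_class_eq: "x \<in> carrier G \<Longrightarrow> y \<in> conj_class G x \<Longrightarrow> conj_class G y = conj_class G x"
  using conj_class_conj[of x] by (auto simp: conj_class_def[of G x])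

lemma commute_mult:
  assumes "x \<in> carrier G" "y \<in> carrier G" "z \<in> carrier G" "x \<otimes> y = y \<otimes> x" "x \<otimes> z = z \<otimes> x"
  shows "x \<otimes> (y \<otimes> z) = (y \<otimes> z) \<otimes> x"
  using assms by (metis m_assoc)

lemma group_center_subset: "group_center G \<subseteq> carrier G"
  by (auto simp: group_center_def)

lemma group_center_comm: "w \<in> group_center G \<Longrightarrow> g \<in> carrier G \<Longrightarrow> w \<otimes> g = g \<otimes> w"
  by (auto simp: group_center_def)

lemma group_center_conj: "x \<in> carrier G \<Longrightarrow> g \<in> carrier G \<Longrightarrow>
  g \<otimes> x \<otimes> inv g \<in> group_center G \<Longrightarrow> x \<in> group_center G"
proof -
  assume x: "x \<in> carrier G" and g: "g \<in> carrier G" and w: "g \<otimes> x \<otimes> inv g \<in> group_center G"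
  have "g \<otimes> x = (g \<otimes> x \<otimes> inv g) \<otimes> g" using x g by (simp add: m_assoc)
  also have "\<dots> = g \<otimes> (g \<otimes> x \<otimes> inv g)" using group_center_comm[OF w g] .
  finally have "x = g \<otimes> x \<otimes> inv g" using x g by simp
  with w show ?thesis by simp
qed

lemma normal_group_center: "group_center G \<lhd> G"
proof (rule normal_invI)
  show "subgroup (group_center G) G"
  proof (rule subgroupI)
    fix a assume a: "a \<in> group_center G"
    then have "inv a \<otimes> g = g \<otimes> inv a" if "g \<in> carrier G" for g
    proof -
      have ac: "a \<in> carrier G" using a group_center_subset by auto
      have "inv a \<otimes> g = inv a \<otimes> (g \<otimes> a) \<otimes> inv a" using that ac by (simp add: m_assoc)
      also have "\<dots> = g \<otimes> inv a"
        unfolding group_center_comm[OF a that, symmetric] using that ac by (simp add: m_assoc)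
      finally show ?thesis .
    qed
    then show "inv a \<in> group_center G" using a group_center_subset by (auto simp: group_center_def)
  next
    fix a b assume ab: "a \<in> group_center G" "b \<in> group_center G"
    then have "a \<in> carrier G" "b \<in> carrier G" using group_center_subset by auto
    moreover from this have "a \<otimes> b \<otimes> g = g \<otimes> (a \<otimes> b)" if "g \<in> carrier G" for g
      using that group_center_comm[OF ab(1) that] group_center_comm[OF ab(2) that] by (metis m_assoc)
    ultimately show "a \<otimes> b \<in> group_center G" by (auto simp: group_center_def)
  qed (auto simp: group_center_def intro: exI[of _ \<one>])
  fix x h assume x: "x \<in> carrier G" and h: "h \<in> group_center G"
  have "x \<otimes> h \<otimes> inv x = h"
    using group_center_comm[OF h x, symmetric] x h group_center_subset by (auto simp: m_assoc)
  with h show "x \<otimes> h \<otimes> inv x \<in> group_center G" by simp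
qed

end

text \<open>Here \<open>p\<close> plays the role of the quotient map by the center followed by the
  isomorphism onto the concrete dihedral group; \<open>snd (p x)\<close> tells whether
  \<open>x\<close> lies over a reflection.\<close>

locale dihedral_central_quotient = group G for G (structure) +
  fixes n :: nat and p :: "'a \<Rightarrow> int \<times> bool"
  assumes finite_carrier: "finite (carrier G)"
    and n_ge_3: "n \<ge> 3"
    and p_hom: "p \<in> hom G (dihedral_group n)"
    and p_surj: "p ` carrier G = carrier (dihedral_group n)"
    and p_kernel: "x \<in> carrier G \<Longrightarrow> p x = (0, False) \<longleftrightarrow> x \<in> group_center G"
begin

lemma p_surjE:
  assumes "0 \<le> i" "i < int n"
  obtains x where "x \<in> carrier G" "p x = (i, a)"
proof -
  have "(i, a) \<in> p ` carrier G" using assms unfolding p_surj by (simp add: dihedral_group_def)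
  then show ?thesis using that by auto
qed

lemma fst_p: assumes "x \<in> carrier G" shows "0 \<le> fst (p x)" "fst (p x) < int n"
proof -
  have "p x \<in> carrier (dihedral_group n)" using assms p_surj by blast
  then show "0 \<le> fst (p x)" "fst (p x) < int n" by (auto simp: dihedral_group_def)
qed

lemma p_mult:
  assumes "x \<in> carrier G" "y \<in> carrier G"
  shows "fst (p (x \<otimes> y)) = (if snd (p x) then fst (p x) - fst (p y) else fst (p x) + fst (p y)) mod int n"
    and "snd (p (x \<otimes> y)) \<longleftrightarrow> snd (p x) \<noteq> snd (p y)"
  using hom_mult[OF p_hom assms] by (auto simp: dihedral_group_def split: prod.splits)

lemma p_one: "p \<one> = (0, False)"
  using p_kernel[of \<one>] by (simp add: group_center_def)

lemma snd_p_inv: "x \<in> carrier G \<Longrightarrow> snd (p (inv x)) = snd (p x)"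
  using p_mult(2)[of x "inv x"] p_one by simp

lemma fst_p_inv:
  assumes "x \<in> carrier G"
  shows "fst (p (inv x)) = (if snd (p x) then fst (p x) else (- fst (p x)) mod int n)"
proof -
  have *: "(if snd (p x) then fst (p x) - fst (p (inv x)) else fst (p x) + fst (p (inv x))) mod int n = 0"
    using p_mult(1)[of x "inv x"] p_one assms by simp
  show ?thesis
  proof (cases "snd (p x)")
    case True
    then have "fst (p x) mod int n = fst (p (inv x)) mod int n"
      using * by (simp add: mod_eq_dvd_iff dvd_eq_mod_eq_0)
    then show ?thesis using True fst_p[OF assms] fst_p[of "inv x"] assms by simp
  next
    case False
    have "fst (p (inv x)) = (- fst (p x) + (fst (p x) + fst (p (inv x)))) mod int n"
      using fst_p[of "inv x"] assms by simp
    also have "\<dots> = (- fst (p x) + (fst (p x) + fst (p (inv x))) mod int n) mod int n"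
      by (simp only: mod_add_right_eq)
    also have "\<dots> = (- fst (p x)) mod int n" using False * by simp
    finally show ?thesis using False by simp
  qed
qed

lemma p_eq_imp_center:
  assumes "x \<in> carrier G" "y \<in> carrier G" "p x = p y"
  shows "inv x \<otimes> y \<in> group_center G"
proof -
  have "fst (p (inv x \<otimes> y)) = 0" "\<not> snd (p (inv x \<otimes> y))"
    using assms by (auto simp: p_mult fst_p_inv snd_p_inv mod_simps)
  then show ?thesis using assms p_kernel[of "inv x \<otimes> y"] by (cases "p (inv x \<otimes> y)") auto
qed

lemma p_mult_center:
  assumes "x \<in> carrier G" "w \<in> group_center G"
  shows "p (x \<otimes> w) = p x"
proof -
  have w: "w \<in> carrier G" "p w = (0, False)" using assms group_center_subset p_kernel by auto
  show ?thesis using assms(1) w fst_p[OF assms(1)] by (auto simp: prod_eq_iff p_mult)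
qed

text \<open>Left multiplication by one preimage maps the center bijectively onto the fiber, which is
  a coset.\<close>

lemma card_fiber:
  assumes "d \<in> carrier (dihedral_group n)"
  shows "card {x \<in> carrier G. p x = d} = card (group_center G)"
proof -
  obtain g where g: "g \<in> carrier G" "p g = d" using assms p_surj by (metis imageE)
  have "bij_betw (\<lambda>w. g \<otimes> w) (group_center G) {x \<in> carrier G. p x = d}"
  proof (rule bij_betw_byWitness[where f' = "\<lambda>x. inv g \<otimes> x"])
    show "(\<lambda>w. g \<otimes> w) ` group_center G \<subseteq> {x \<in> carrier G. p x = d}"
      using g p_mult_center group_center_subset by auto
    show "(\<lambda>x. inv g \<otimes> x) ` {x \<in> carrier G. p x = d} \<subseteq> group_center G"
      using g p_eq_imp_center by auto
  qed (use g group_center_subset in \<open>auto simp: m_assoc[symmetric]\<close>)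
  then show ?thesis by (metis bij_betw_same_card)
qed

lemma card_preimage:
  assumes "S \<subseteq> carrier (dihedral_group n)"
  shows "card {x \<in> carrier G. p x \<in> S} = card (group_center G) * card S"
proof -
  have fS: "finite S" using assms by (rule finite_subset) (simp add: dihedral_group_def)
  have "{x \<in> carrier G. p x \<in> S} = (\<Union>d\<in>S. {x \<in> carrier G. p x = d})" by auto
  also have "card \<dots> = (\<Sum>d\<in>S. card {x \<in> carrier G. p x = d})"
    using finite_carrier fS by (intro card_UN_disjoint) auto
  also have "\<dots> = (\<Sum>d\<in>S. card (group_center G))"
    using assms by (intro sum.cong) (auto simp: card_fiber)
  finally show ?thesis by (simp add: mult.commute)
qed

text \<open>The elements differ by a central factor.\<close>

lemma p_eq_imp_comm:
  assumes "x \<in> carrier G" "y \<in> carrier G" "p x = p y"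
  shows "x \<otimes> y = y \<otimes> x"
proof -
  have w: "inv x \<otimes> y \<in> group_center G" using p_eq_imp_center assms by auto
  have "x \<otimes> (x \<otimes> (inv x \<otimes> y)) = x \<otimes> (inv x \<otimes> y) \<otimes> x"
    using assms by (intro commute_mult refl group_center_comm[OF w, symmetric]) auto
  then show ?thesis using assms by (simp add: m_assoc[symmetric])
qed

text \<open>A lift of the generating rotation; its powers meet every coset of the center lying over
  the rotations.\<close>

definition rot :: 'a where "rot = (SOME x. x \<in> carrier G \<and> p x = (1, False))"

lemma rot: "rot \<in> carrier G" "p rot = (1, False)"
proof -
  obtain x where "x \<in> carrier G" "p x = (1, False)"
    using p_surjE[of 1 False] n_ge_3 by auto
  then have "\<exists>x. x \<in> carrier G \<and> p x = (1, False)" by blast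
  from someI_ex[OF this] show "rot \<in> carrier G" "p rot = (1, False)" by (auto simp: rot_def)
qed

lemma p_rot_pow: "p (rot [^] i) = (int i mod int n, False)"
proof (induction i)
  case 0
  show ?case by (simp add: p_one)
next
  case (Suc i)
  then show ?case using rot by (auto simp: prod_eq_iff p_mult mod_simps add.commute)
qed

lemma rot_pow_closed [simp]: "rot [^] (i::nat) \<in> carrier G"
  using rot by simp

lemma rot_pow_comm: "rot [^] (i::nat) \<otimes> rot [^] (j::nat) = rot [^] j \<otimes> rot [^] i"
  using rot by (simp add: nat_pow_mult add.commute)

lemma rotation_eq:
  assumes "x \<in> carrier G" "\<not> snd (p x)"
  obtains i w where "i < n" "w \<in> group_center G" "x = rot [^] (i::nat) \<otimes> w"
proof
  define i where "i = nat (fst (p x))"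
  show "i < n" using fst_p[OF assms(1)] by (auto simp: i_def)
  have "int i = fst (p x)" using fst_p[OF assms(1)] by (simp add: i_def)
  then have "p (rot [^] i) = p x"
    using assms(2) fst_p[OF assms(1)] by (simp add: p_rot_pow prod_eq_iff)
  then show "inv (rot [^] i) \<otimes> x \<in> group_center G" using assms by (intro p_eq_imp_center) auto
  show "x = rot [^] i \<otimes> (inv (rot [^] i) \<otimes> x)" using assms by (simp add: m_assoc[symmetric])
qed

text \<open>The preimage of the rotations is generated by \<open>rot\<close> and the center, hence
  abelian.\<close>

lemma rotations_comm:
  assumes x: "x \<in> carrier G" "\<not> snd (p x)" and y: "y \<in> carrier G" "\<not> snd (p y)"
  shows "x \<otimes> y = y \<otimes> x"
proof -
  obtain i v where iv: "v \<in> group_center G" "x = rot [^] (i::nat) \<otimes> v" using rotation_eq[OF x] .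
  obtain j w where jw: "w \<in> group_center G" "y = rot [^] (j::nat) \<otimes> w" using rotation_eq[OF y] .
  have vw: "v \<in> carrier G" "w \<in> carrier G" using iv jw group_center_subset by auto
  have "rot [^] i \<otimes> y = y \<otimes> rot [^] i"
    unfolding jw using vw group_center_comm[OF jw(1)] by (intro commute_mult rot_pow_comm) auto
  then have "y \<otimes> x = x \<otimes> y"
    unfolding iv using vw y group_center_comm[OF iv(1)] by (intro commute_mult) auto
  then show ?thesis by simp
qed

text \<open>The abelian preimage of the rotations has index 2, so together with \<open>x\<close> it
  generates the group, and \<open>h\<close> commutes with both.\<close>

lemma rotation_comm_reflection_imp_center:
  assumes h: "h \<in> carrier G" "\<not> snd (p h)" and x: "x \<in> carrier G" "snd (p x)"
    and hx: "h \<otimes> x = x \<otimes> h"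
  shows "h \<in> group_center G"
proof -
  have "h \<otimes> g = g \<otimes> h" if g: "g \<in> carrier G" for g
  proof (cases "snd (p g)")
    case True
    \<comment> \<open>The factor \<open>g \<otimes> inv x\<close> is a product of two reflections,
      thus a rotation.\<close>
    have "h \<otimes> (g \<otimes> inv x \<otimes> x) = g \<otimes> inv x \<otimes> x \<otimes> h"
      using h x g True by (intro commute_mult hx rotations_comm) (auto simp: p_mult snd_p_inv)
    then show ?thesis using x g by (simp add: m_assoc)
  qed (use h g rotations_comm in auto)
  then show ?thesis using h by (auto simp: group_center_def)
qed

section \<open>Sizes of conjugacy classes and counting the classes\<close>

lemma snd_p_conj:
  assumes "x \<in> carrier G" "g \<in> carrier G"
  shows "snd (p (g \<otimes> x \<otimes> inv g)) = snd (p x)"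
  using assms by (auto simp: p_mult snd_p_inv)

text \<open>Up to sign, conjugation shifts the rotation part by an even amount, so its parity is an
  invariant when \<open>n\<close> is even.\<close>

lemma fst_p_conj_reflection:
  assumes "x \<in> carrier G" "g \<in> carrier G" "snd (p x)"
  shows "fst (p (g \<otimes> x \<otimes> inv g)) =
    (2 * fst (p g) + (if snd (p g) then - fst (p x) else fst (p x))) mod int n"
proof (cases "snd (p g)")
  case True
  then have "fst (p (g \<otimes> x \<otimes> inv g)) = ((fst (p g) - fst (p x)) mod int n + fst (p g)) mod int n"
    using assms by (simp add: p_mult fst_p_inv)
  also have "\<dots> = (fst (p g) - fst (p x) + fst (p g)) mod int n"
    by (simp only: mod_add_left_eq)
  also have "fst (p g) - fst (p x) + fst (p g) = 2 * fst (p g) + - fst (p x)" by simp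
  finally show ?thesis using True by simp
next
  case False
  then have "fst (p (g \<otimes> x \<otimes> inv g)) =
      ((fst (p g) + fst (p x)) mod int n - (- fst (p g)) mod int n) mod int n"
    using assms by (simp add: p_mult fst_p_inv)
  also have "\<dots> = (fst (p g) + fst (p x) - - fst (p g)) mod int n"
    by (simp only: mod_diff_eq)
  also have "fst (p g) + fst (p x) - - fst (p g) = 2 * fst (p g) + fst (p x)" by simp
  finally show ?thesis using False by simp
qed

text \<open>Rotations act trivially on \<open>h\<close>, and all reflections act like
  \<open>s\<close>, from which they differ by a rotation. The two conjugates are distinct, as
  \<open>h\<close> would otherwise commute with \<open>s\<close> and be central.\<close>

lemma card_conj_class_rotation:
  assumes h: "h \<in> carrier G - group_center G" "\<not> snd (p h)"
  shows "card (conj_class G h) = 2"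
proof -
  obtain s where s: "s \<in> carrier G" "p s = (0, True)" using p_surjE[of 0 True] n_ge_3 by auto
  have hc: "h \<in> carrier G" using h by simp
  have "g \<otimes> h \<otimes> inv g \<in> {h, s \<otimes> h \<otimes> inv s}" if g: "g \<in> carrier G" for g
  proof (cases "snd (p g)")
    case False
    then have "g \<otimes> h = h \<otimes> g" using g hc h(2) rotations_comm by auto
    then show ?thesis using g hc by (simp add: m_assoc)
  next
    case True
    define k where "k = inv s \<otimes> g"
    have k: "k \<in> carrier G" "\<not> snd (p k)" "g = s \<otimes> k"
      using True g s by (auto simp: k_def p_mult snd_p_inv m_assoc[symmetric])
    then have kh: "k \<otimes> h = h \<otimes> k" using hc h(2) rotations_comm by auto
    have "g \<otimes> h \<otimes> inv g = s \<otimes> (k \<otimes> h) \<otimes> inv k \<otimes> inv s"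
      using k s hc by (simp add: inv_mult_group m_assoc)
    also have "\<dots> = s \<otimes> h \<otimes> inv s"
      unfolding kh using k s hc by (simp add: m_assoc)
    finally show ?thesis by simp
  qed
  then have "conj_class G h \<subseteq> {h, s \<otimes> h \<otimes> inv s}" by (auto simp: conj_class_def)
  moreover have "s \<otimes> h \<otimes> inv s \<in> conj_class G h" using s by (auto simp: conj_class_def)
  ultimately have "conj_class G h = {h, s \<otimes> h \<otimes> inv s}"
    using conj_class_self[OF hc] by blast
  moreover have "h \<noteq> s \<otimes> h \<otimes> inv s"
  proof
    assume "h = s \<otimes> h \<otimes> inv s"
    then have "h \<otimes> s = s \<otimes> h \<otimes> inv s \<otimes> s" by simp
    then have "h \<otimes> s = s \<otimes> h" using s hc by (simp add: m_assoc)
    then show False using rotation_comm_reflection_imp_center[of h s] h s by auto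
  qed
  ultimately show ?thesis by simp
qed

text \<open>The class is the orbit under the first \<open>n\<close> powers of \<open>rot\<close>:
  these conjugates are distinct because only central rotations commute with \<open>x\<close>, and
  every conjugator reduces to such a power.\<close>

lemma card_conj_class_reflection:
  assumes x: "x \<in> carrier G" "snd (p x)"
  shows "card (conj_class G x) = n"
proof -
  define c where "c i = rot [^] i \<otimes> x \<otimes> inv (rot [^] i)" for i :: nat
  have "inj_on c {..<n}"
  proof (rule inj_onI)
    fix i j assume ij: "i \<in> {..<n}" "j \<in> {..<n}" "c i = c j"
    let ?h = "inv (rot [^] j) \<otimes> rot [^] i"
    have "?h \<otimes> x = inv (rot [^] j) \<otimes> c i \<otimes> rot [^] i"
      using x by (simp add: c_def m_assoc)
    also have "\<dots> = x \<otimes> ?h"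
      unfolding ij(3) using x by (simp add: c_def m_assoc[symmetric])
    finally have "?h \<in> group_center G"
      using x by (intro rotation_comm_reflection_imp_center[of _ x]) (auto simp: p_mult snd_p_inv p_rot_pow)
    then have "p (rot [^] j \<otimes> ?h) = p (rot [^] j)" by (intro p_mult_center) auto
    then have "p (rot [^] i) = p (rot [^] j)" by (simp add: m_assoc[symmetric])
    then show "i = j" using ij by (simp add: p_rot_pow)
  qed
  moreover have "c ` {..<n} = conj_class G x"
  proof
    show "c ` {..<n} \<subseteq> conj_class G x" by (auto simp: c_def conj_class_def)
    show "conj_class G x \<subseteq> c ` {..<n}"
    proof
      fix y assume "y \<in> conj_class G x"
      then obtain g where g: "g \<in> carrier G" "y = g \<otimes> x \<otimes> inv g" by (auto simp: conj_class_def)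
      \<comment> \<open>Multiplying \<open>g\<close> on the right by \<open>x\<close> leaves the
        conjugate unchanged and makes a reflection a rotation.\<close>
      define k where "k = (if snd (p g) then g \<otimes> x else g)"
      have k: "k \<in> carrier G" "\<not> snd (p k)" using g x by (auto simp: k_def p_mult)
      have y: "y = k \<otimes> x \<otimes> inv k" using g x by (auto simp: k_def m_assoc inv_mult_group)
      obtain i w where iw: "i < n" "w \<in> group_center G" "k = rot [^] (i::nat) \<otimes> w"
        using rotation_eq[OF k] .
      have w: "w \<in> carrier G" using iw group_center_subset by auto
      have "y = rot [^] i \<otimes> (w \<otimes> x) \<otimes> inv w \<otimes> inv (rot [^] i)"
        unfolding y iw using w x by (simp add: m_assoc inv_mult_group)
      also have "\<dots> = c i"
        unfolding group_center_comm[OF iw(2) x(1)] c_def using w x by (simp add: m_assoc)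
      finally show "y \<in> c ` {..<n}" using iw(1) by auto
    qed
  qed
  ultimately show ?thesis by (metis card_image card_lessThan)
qed

text \<open>Double counting: the preimage of \<open>S\<close> is partitioned into classes of the
  common size \<open>k\<close>.\<close>

lemma card_conj_classes:
  assumes S: "S \<subseteq> carrier (dihedral_group n)"
    and inv: "\<And>x g. x \<in> carrier G \<Longrightarrow> g \<in> carrier G \<Longrightarrow> p x \<in> S \<Longrightarrow> p (g \<otimes> x \<otimes> inv g) \<in> S"
    and k: "\<And>x. x \<in> carrier G \<Longrightarrow> p x \<in> S \<Longrightarrow> card (conj_class G x) = k"
  shows "k * card (conj_class G ` {x \<in> carrier G. p x \<in> S}) = card (group_center G) * card S"
proof -
  let ?A = "{x \<in> carrier G. p x \<in> S}"
  have U: "\<Union> (conj_class G ` ?A) = ?A"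
  proof
    show "\<Union> (conj_class G ` ?A) \<subseteq> ?A" using inv by (auto simp: conj_class_def)
    show "?A \<subseteq> \<Union> (conj_class G ` ?A)" using conj_class_self by blast
  qed
  have "k * card (conj_class G ` ?A) = card (\<Union> (conj_class G ` ?A))"
  proof (rule card_partition)
    fix X Y assume "X \<in> conj_class G ` ?A" "Y \<in> conj_class G ` ?A" "X \<noteq> Y"
    then show "X \<inter> Y = {}" using conj_class_eq by blast
  qed (use finite_carrier k U in auto)
  then show ?thesis unfolding U card_preimage[OF S] .
qed

text \<open>
  For odd \<open>n\<close> all reflections of the dihedral group are conjugate; for even \<open>n\<close> they form two
  classes, told apart by the parity of the rotation part.
\<close>

definition label :: "'a \<Rightarrow> nat" where
  "label x = (if \<not> snd (p x) then 0 else if even n \<and> odd (fst (p x)) then 2 else 1)"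

lemma label_conj:
  assumes "x \<in> carrier G" "g \<in> carrier G"
  shows "label (g \<otimes> x \<otimes> inv g) = label x"
proof -
  have "even (fst (p (g \<otimes> x \<otimes> inv g))) \<longleftrightarrow> even (fst (p x))" if "snd (p x)" "even n"
    unfolding fst_p_conj_reflection[OF assms that(1)] using that(2) by (simp add: dvd_mod_iff)
  then show ?thesis unfolding label_def snd_p_conj[OF assms] by auto
qed

lemma label_eq_0: "label x = 0 \<longleftrightarrow> \<not> snd (p x)"
  by (simp add: label_def)

text \<open>For commuting reflections, \<open>inv x \<otimes> y\<close> is a rotation commuting with
  \<open>x\<close>, hence central, so the images under \<open>p\<close> agree. In a mixed pair the
  rotation would be central.\<close>

lemma comm_imp_label_eq:
  assumes x: "x \<in> carrier G - group_center G" and y: "y \<in> carrier G - group_center G"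
    and xy: "x \<otimes> y = y \<otimes> x"
  shows "label x = label y"
proof (cases "snd (p x) \<and> snd (p y)")
  case True
  have "inv x \<otimes> y \<otimes> x = x \<otimes> (inv x \<otimes> y)"
  proof -
    have "inv x \<otimes> y \<otimes> x = inv x \<otimes> (x \<otimes> y)" unfolding xy using x y by (simp add: m_assoc)
    then show ?thesis using x y by simp
  qed
  then have "inv x \<otimes> y \<in> group_center G"
    using x y True by (intro rotation_comm_reflection_imp_center[of _ x]) (auto simp: p_mult snd_p_inv)
  then have "p (x \<otimes> (inv x \<otimes> y)) = p x" using x by (intro p_mult_center) auto
  then have "p x = p y" using x y by (simp add: m_assoc[symmetric])
  then show ?thesis by (simp add: label_def)
next
  case False
  then have "\<not> snd (p x) \<and> \<not> snd (p y)"
    using rotation_comm_reflection_imp_center[OF _ _ _ _ xy]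
      rotation_comm_reflection_imp_center[OF _ _ _ _ xy[symmetric]] x y by blast
  then show ?thesis by (simp add: label_def)
qed

text \<open>Rotations commute already. A reflection can be conjugated by a power of
  \<open>rot\<close> into the fiber of \<open>y\<close>, provided the difference of rotation parts
  is a double modulo \<open>n\<close>.\<close>

lemma label_eq_imp_comm:
  assumes x: "x \<in> carrier G" and y: "y \<in> carrier G" and eq: "label x = label y"
  obtains g where "g \<in> carrier G" "g \<otimes> x \<otimes> inv g \<otimes> y = y \<otimes> (g \<otimes> x \<otimes> inv g)"
proof (cases "snd (p x)")
  case False
  then have "\<not> snd (p y)" using eq label_eq_0[of x] label_eq_0[of y] by simp
  with False have "x \<otimes> y = y \<otimes> x" using x y by (intro rotations_comm)
  then show ?thesis using x y by (intro that[of \<one>]) auto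
next
  case True
  then have y': "snd (p y)" using eq label_eq_0[of x] label_eq_0[of y] by simp
  have "\<exists>q. (2 * q) mod int n = (fst (p y) - fst (p x)) mod int n"
  proof (cases "even n")
    case True
    then have "even (fst (p y) - fst (p x))" using \<open>snd (p x)\<close> y' eq by (auto simp: label_def split: if_splits)
    then show ?thesis by (metis evenE)
  next
    case False
    then obtain m where "int n = 2 * m + 1" by (metis even_of_nat oddE)
    \<comment> \<open>For n = 2 m + 1 the inverse of 2 modulo n is m + 1.\<close>
    then have "2 * ((m + 1) * u) = u + int n * u" for u by (simp add: algebra_simps)
    then have "(2 * ((m + 1) * u)) mod int n = u mod int n" for u by (metis mod_mult_self2)
    then show ?thesis by blast
  qed
  then obtain q where q: "(2 * q) mod int n = (fst (p y) - fst (p x)) mod int n" ..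
  define i where "i = nat (q mod int n)"
  have i: "int i = q mod int n" using n_ge_3 by (simp add: i_def)
  let ?x = "rot [^] i \<otimes> x \<otimes> inv (rot [^] i)"
  have "fst (p ?x) = (2 * (q mod int n) + fst (p x)) mod int n"
    using True x by (simp add: fst_p_conj_reflection p_rot_pow i)
  also have "\<dots> = (fst (p y) - fst (p x) + fst (p x)) mod int n"
    using q by (intro mod_add_cong refl) (simp add: mod_mult_right_eq)
  also have "\<dots> = fst (p y)" using fst_p[OF y] by simp
  finally have "p ?x = p y" using True y' x by (simp add: prod_eq_iff snd_p_conj)
  then have "?x \<otimes> y = y \<otimes> ?x" using x y by (intro p_eq_imp_comm) auto
  then show ?thesis by (intro that[of "rot [^] i"]) auto
qed

end

section \<open>The graph as a union of cliques, and the clique sizes\<close>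

context dihedral_central_quotient
begin

text \<open>The choice of representative does not matter, since \<open>label\<close> is constant on
  conjugacy classes.\<close>

definition class_label :: "'a set \<Rightarrow> nat" where
  "class_label X = label (SOME x. x \<in> X)"

lemma class_label: "x \<in> carrier G \<Longrightarrow> class_label (conj_class G x) = label x"
proof -
  assume x: "x \<in> carrier G"
  then have "(SOME y. y \<in> conj_class G x) \<in> conj_class G x"
    using conj_class_self by (metis someI)
  then show ?thesis using label_conj[OF x] by (auto simp: class_label_def conj_class_def)
qed

lemma pverts_ccc_graph: "pverts (ccc_graph G) = conj_class G ` (carrier G - group_center G)"
  by (simp add: ccc_graph_def)

text \<open>Members of a noncentral class are noncentral with the same label, so commuting members
  force equal labels. Conversely it suffices to conjugate one representative and keep the
  other.\<close>

lemma ccc_graph_arcs_iff: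
  "(X, Y) \<in> parcs (ccc_graph G) \<longleftrightarrow>
    X \<in> pverts (ccc_graph G) \<and> Y \<in> pverts (ccc_graph G) \<and> X \<noteq> Y \<and> class_label X = class_label Y"
proof -
  have "(\<exists>x\<in>X. \<exists>y\<in>Y. x \<otimes> y = y \<otimes> x) \<longleftrightarrow> class_label X = class_label Y"
    if X: "X \<in> pverts (ccc_graph G)" and Y: "Y \<in> pverts (ccc_graph G)"
  proof -
    obtain u where u: "u \<in> carrier G - group_center G" "X = conj_class G u"
      using X by (auto simp: pverts_ccc_graph)
    obtain v where v: "v \<in> carrier G - group_center G" "Y = conj_class G v"
      using Y by (auto simp: pverts_ccc_graph)
    have lab: "class_label X = label u" "class_label Y = label v"
      using u v class_label by auto
    show ?thesis
    proof
      assume "\<exists>x\<in>X. \<exists>y\<in>Y. x \<otimes> y = y \<otimes> x"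
      then obtain x y where xy: "x \<in> X" "y \<in> Y" "x \<otimes> y = y \<otimes> x" by blast
      have nc: "x' \<in> carrier G - group_center G \<and> label x' = label u'"
        if "u' \<in> carrier G - group_center G" "x' \<in> conj_class G u'" for x' u'
        using that group_center_conj label_conj by (auto simp: conj_class_def)
      have "label x = label y"
        using nc[of u x] nc[of v y] u v xy by (intro comm_imp_label_eq) auto
      then show "class_label X = class_label Y"
        using nc[of u x] nc[of v y] u v xy lab by simp
    next
      assume "class_label X = class_label Y"
      then obtain g where "g \<in> carrier G" "g \<otimes> u \<otimes> inv g \<otimes> v = v \<otimes> (g \<otimes> u \<otimes> inv g)"
        using label_eq_imp_comm[of u v] u v lab by auto
      then show "\<exists>x\<in>X. \<exists>y\<in>Y. x \<otimes> y = y \<otimes> x"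
        using conj_class_self[of v] u v by (auto simp: conj_class_def[of G u])
    qed
  qed
  then show ?thesis by (auto simp: ccc_graph_def)
qed

sublocale ccc: clique_union "ccc_graph G" class_label
proof
  show "finite (pverts (ccc_graph G))" using finite_carrier by (simp add: pverts_ccc_graph)
qed (rule ccc_graph_arcs_iff)

text \<open>Transports the block to the dihedral group, where omitting the identity corresponds to
  omitting the center.\<close>

lemma block_eq:
  assumes "S = {d \<in> carrier (dihedral_group n). d \<noteq> (0, False) \<and>
    (if \<not> snd d then 0 else if even n \<and> odd (fst d) then 2 else 1) = b}"
  shows "ccc.block b = conj_class G ` {x \<in> carrier G. p x \<in> S}"
proof -
  have "{x \<in> carrier G. p x \<in> S} = {x \<in> carrier G - group_center G. label x = b}"
    using p_surj p_kernel unfolding assms label_def by auto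
  also have "\<dots> = {x \<in> carrier G - group_center G. class_label (conj_class G x) = b}"
    using class_label by auto
  finally show ?thesis
    by (auto simp: ccc.block_def pverts_ccc_graph)
qed

lemma card_block:
  assumes S: "S = {d \<in> carrier (dihedral_group n). d \<noteq> (0, False) \<and>
    (if \<not> snd d then 0 else if even n \<and> odd (fst d) then 2 else 1) = b}"
    and k: "k = (if b = 0 then 2 else n)"
  shows "k * card (ccc.block b) = card (group_center G) * card S"
  unfolding block_eq[OF S]
proof (rule card_conj_classes)
  have *: "p x \<in> S \<longleftrightarrow> x \<notin> group_center G \<and> label x = b" if "x \<in> carrier G" for x
    using p_surj p_kernel that unfolding S label_def by auto
  show "S \<subseteq> carrier (dihedral_group n)" by (auto simp: S)
  fix x assume x: "x \<in> carrier G" "p x \<in> S"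
  show "p (g \<otimes> x \<otimes> inv g) \<in> S" if g: "g \<in> carrier G" for g
  proof -
    have "g \<otimes> x \<otimes> inv g \<in> carrier G" using x(1) g by simp
    from *[OF this] *[OF x(1)] show ?thesis
      using x(2) group_center_conj[OF x(1) g] label_conj[OF x(1) g] by auto
  qed
  have "x \<in> carrier G - group_center G" "label x = b" using * x by auto
  then show "card (conj_class G x) = k"
    using card_conj_class_rotation[of x] card_conj_class_reflection[of x] label_eq_0[of x] x(1) k by auto
qed

lemma card_block_rotations: "2 * card (ccc.block 0) = card (group_center G) * (n - 1)"
proof -
  have "{d \<in> carrier (dihedral_group n). d \<noteq> (0, False) \<and>
      (if \<not> snd d then 0 else if even n \<and> odd (fst d) then 2 else 1) = (0::nat)} = {1..<int n} \<times> {False}"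
    by (auto simp: dihedral_group_def)
  from card_block[OF this[symmetric] refl] show ?thesis
    using n_ge_3 by (simp add: card_cartesian_product nat_diff_distrib)
qed

lemma card_block_reflections_odd:
  assumes "odd n"
  shows "card (ccc.block (Suc 0)) = card (group_center G)"
proof -
  have "{d \<in> carrier (dihedral_group n). d \<noteq> (0, False) \<and>
      (if \<not> snd d then 0 else if even n \<and> odd (fst d) then 2 else 1) = Suc 0} = {0..<int n} \<times> {True}"
    using assms by (auto simp: dihedral_group_def)
  from card_block[OF this[symmetric] refl] show ?thesis
    using n_ge_3 by (simp add: card_cartesian_product)
qed

lemma card_block_reflections_even:
  assumes "even n" "b \<in> {1, 2}"
  shows "2 * card (ccc.block b) = card (group_center G)"
proof -
  obtain m where m: "n = 2 * m" using assms by (auto elim: evenE)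
  \<comment> \<open>The parity of the rotation parts of the reflections with label \<open>b\<close>;
    each parity occurs n / 2 times.\<close>
  define c :: int where "c = (if b = 1 then 0 else 1)"
  have "{d \<in> carrier (dihedral_group n). d \<noteq> (0, False) \<and>
      (if \<not> snd d then 0 else if even n \<and> odd (fst d) then 2 else 1) = b}
      = (\<lambda>i. (2 * i + c, True)) ` {0..<int m}" (is "?S = _")
  proof
    show "?S \<subseteq> (\<lambda>i. (2 * i + c, True)) ` {0..<int m}"
    proof
      fix d assume d: "d \<in> ?S"
      then have "snd d" "0 \<le> fst d" "fst d < 2 * int m" "even (fst d) \<longleftrightarrow> b = 1"
        using assms m by (auto simp: dihedral_group_def split: if_splits)
      then have "2 * (fst d div 2) + c = fst d" "fst d div 2 \<in> {0..<int m}"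
        by (auto simp: c_def odd_two_times_div_two_succ)
      then show "d \<in> (\<lambda>i. (2 * i + c, True)) ` {0..<int m}"
        using \<open>snd d\<close> by (intro image_eqI[of _ _ "fst d div 2"]) (auto simp: prod_eq_iff)
    qed
    show "(\<lambda>i. (2 * i + c, True)) ` {0..<int m} \<subseteq> ?S"
      using assms m by (auto simp: dihedral_group_def c_def)
  qed
  moreover have "card ((\<lambda>i. (2 * i + c, True)) ` {0..<int m}) = m"
    by (subst card_image) (auto simp: inj_on_def)
  ultimately have "n * card (ccc.block b) = card (group_center G) * m"
    using card_block[OF refl refl, of b] assms(2) by auto
  then show ?thesis using m n_ge_3 by simp
qed

lemma card_group_center_pos: "card (group_center G) > 0"
proof -
  have "\<one> \<in> group_center G" by (simp add: group_center_def)
  moreover have "finite (group_center G)"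
    using finite_carrier group_center_subset by (rule finite_subset[rotated])
  ultimately show ?thesis by (auto simp: card_gt_0_iff)
qed

lemma labels_eq_nonempty_blocks: "class_label ` pverts (ccc_graph G) = {b. ccc.block b \<noteq> {}}"
  by (auto simp: ccc.block_def)

text \<open>All possible labels occur because the counted blocks are nonempty; this fixes the number
  of cliques in the sums.\<close>

lemma labels: "class_label ` pverts (ccc_graph G) = (if even n then {0, 1, 2} else {0, 1})"
proof -
  have "b \<in> (if even n then {0, 1, 2} else {0, 1})" if "ccc.block b \<noteq> {}" for b
  proof -
    obtain X where "X \<in> pverts (ccc_graph G)" "class_label X = b"
      using \<open>ccc.block b \<noteq> {}\<close> by (auto simp: ccc.block_def)
    then obtain x where "x \<in> carrier G" "b = label x"
      using class_label by (auto simp: pverts_ccc_graph)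
    then show ?thesis by (auto simp: label_def)
  qed
  moreover have "ccc.block b \<noteq> {}" if "b \<in> (if even n then {0, 1, 2} else {0, 1})" for b
  proof -
    have "card (ccc.block b) \<noteq> 0"
    proof (cases "b = 0")
      case True
      have "card (group_center G) * (n - 1) > 0" using card_group_center_pos n_ge_3 by simp
      then show ?thesis unfolding True card_block_rotations[symmetric] by simp
    next
      case False
      then show ?thesis
        using that card_block_reflections_odd card_block_reflections_even[of b] card_group_center_pos
        by (auto split: if_splits)
    qed
    then show ?thesis by auto
  qed
  ultimately show ?thesis unfolding labels_eq_nonempty_blocks by blast
qed

end

lemma (in group) obtain_dihedral_central_quotient:
  assumes "finite (carrier G)" "n \<ge> 3" "G Mod group_center G \<cong> dihedral_group n"
  obtains p where "dihedral_central_quotient G n p"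
proof -
  obtain \<phi> where \<phi>: "\<phi> \<in> iso (G Mod group_center G) (dihedral_group n)"
    using assms(3) by (auto simp: is_iso_def)
  define p where "p x = \<phi> (group_center G #> x)" for x
  interpret Z: normal "group_center G" G by (rule normal_group_center)
  interpret Q: group "G Mod group_center G" by (rule Z.factorgroup_is_group)
  interpret D: group "dihedral_group n" using assms(2) by (intro group_dihedral_group) simp
  have hom: "\<phi> \<in> hom (G Mod group_center G) (dihedral_group n)"
    and bij: "bij_betw \<phi> (carrier (G Mod group_center G)) (carrier (dihedral_group n))"
    using \<phi> by (auto simp: iso_def)
  have "\<phi> (group_center G) = (0, False)"
    using hom_one[OF hom Q.is_group D.is_group] by (simp add: dihedral_group_def)
  have "dihedral_central_quotient G n p"
  proof
    have "\<phi> \<circ> (\<lambda>x. group_center G #> x) \<in> hom G (dihedral_group n)"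
      by (rule Group.hom_compose[OF Z.r_coset_hom_Mod hom])
    then show "p \<in> hom G (dihedral_group n)" by (simp add: p_def[abs_def] comp_def)
    show "p ` carrier G = carrier (dihedral_group n)"
      using bij by (auto simp: bij_betw_def carrier_FactGroup p_def image_image)
    fix x assume x: "x \<in> carrier G"
    have "p x = (0, False) \<longleftrightarrow> \<phi> (group_center G #> x) = \<phi> (group_center G)"
      by (simp add: p_def \<open>\<phi> (group_center G) = _\<close>)
    \<comment> \<open>Injectivity of \<phi> identifies the kernel of \<open>p\<close> with the
      center.\<close>
    also have "\<dots> \<longleftrightarrow> group_center G #> x = group_center G"
      using bij x Q.one_closed
      by (intro inj_on_eq_iff[of \<phi> "carrier (G Mod group_center G)"])
        (auto simp: bij_betw_def carrier_FactGroup)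
    also have "\<dots> \<longleftrightarrow> x \<in> group_center G"
      using x Z.subgroup_axioms by (metis coset_join1 coset_join2 group_center_subset)
    finally show "p x = (0, False) \<longleftrightarrow> x \<in> group_center G" .
  qed (use assms in auto)
  then show ?thesis by (rule that)
qed

theorem theorem3p10:
  fixes G :: "('a, 'b) monoid_scheme" and n z :: nat
  assumes "group G" and "finite (carrier G)"
    and "n \<ge> 3"
    and "G Mod group_center G \<cong> dihedral_group n"
    and "z = card (group_center G)"
  shows "((n = 3 \<and> z \<ge> 1) \<or> (n = 5 \<and> z = 1) \<longrightarrow>
            E_CN (ccc_graph G) = LE_CN (ccc_graph G) \<and>
            LE_CN (ccc_graph G) = LE_plus_CN (ccc_graph G)) \<and>
         (\<not> ((n = 3 \<and> z \<ge> 1) \<or> (n = 5 \<and> z = 1)) \<longrightarrow>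
            E_CN (ccc_graph G) < LE_plus_CN (ccc_graph G) \<and>
            LE_plus_CN (ccc_graph G) < LE_CN (ccc_graph G))"
proof -
  obtain p where "dihedral_central_quotient G n p"
    using group.obtain_dihedral_central_quotient[OF assms(1-4)] .
  then interpret dihedral_central_quotient G n p .
  define a b where "a = ccc.block_size 0" and "b = ccc.block_size (Suc 0)"
  have z: "z \<ge> 1" using card_group_center_pos assms(5) by simp
  have a: "2 * a = (real n - 1) * real z"
  proof -
    have "real (2 * card (ccc.block 0)) = real (z * (n - 1))"
      unfolding card_block_rotations assms(5) ..
    then show ?thesis using n_ge_3 by (simp add: a_def ccc.block_size_def of_nat_diff mult.commute)
  qed
  have b_nat: "b = 1 \<or> b \<ge> 2"
  proof -
    have "b \<ge> 1" unfolding b_def using labels by (intro ccc.block_size_ge_1) auto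
    then show ?thesis by (auto simp: b_def ccc.block_size_def)
  qed
  \<comment> \<open>The number of reflection cliques, all of size \<open>b\<close>.\<close>
  define t :: real where "t = (if even n then 2 else 1)"
  have t: "t * b = real z"
    using card_block_reflections_odd card_block_reflections_even[of 1]
    by (auto simp: t_def b_def ccc.block_size_def assms(5))
  have sum_labels: "(\<Sum>l\<in>class_label ` pverts (ccc_graph G). g (ccc.block_size l)) = g a + t * g b"
    for g :: "real \<Rightarrow> real"
  proof -
    have "ccc.block_size 2 = b" if "even n"
      using card_block_reflections_even[OF that, of 1] card_block_reflections_even[OF that, of 2]
      by (simp add: b_def ccc.block_size_def)
    then show ?thesis by (simp add: labels a_def b_def t_def)
  qed
  \<comment> \<open>The ratio of the clique sizes, from 2 a = (n - 1) z and z = t b.\<close>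
  define k where "k = (real n - 1) * t / 2"
  have ak: "a = k * b" using a unfolding t[symmetric] k_def by simp
  define D where "D = CN_mean (ccc_graph G)"
  have D: "D = (a * ((a - 1) * (a - 2)) + t * (b * ((b - 1) * (b - 2)))) / (a + t * b)"
    unfolding D_def ccc.CN_mean_eq sum_labels[of "\<lambda>s. s"]
    unfolding sum_labels[of "\<lambda>s. s * ((s - 1) * (s - 2))"] ..
  have E: "E_CN (ccc_graph G) = 2 * (a - 1) * \<bar>a - 2\<bar> + t * (2 * (b - 1) * \<bar>b - 2\<bar>)"
    unfolding ccc.E_CN_eq sum_labels[of "\<lambda>s. 2 * (s - 1) * \<bar>s - 2\<bar>"] ..
  have L: "LE_CN (ccc_graph G) =
      \<bar>D\<bar> + (a - 1) * \<bar>a * (a - 2) - D\<bar> + t * (\<bar>D\<bar> + (b - 1) * \<bar>b * (b - 2) - D\<bar>)"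
    unfolding ccc.LE_CN_eq D_def[symmetric]
      sum_labels[of "\<lambda>s. \<bar>D\<bar> + (s - 1) * \<bar>s * (s - 2) - D\<bar>"] ..
  have P: "LE_plus_CN (ccc_graph G) =
      \<bar>2 * (a - 1) * (a - 2) - D\<bar> + (a - 1) * \<bar>(a - 2)^2 - D\<bar>
      + t * (\<bar>2 * (b - 1) * (b - 2) - D\<bar> + (b - 1) * \<bar>(b - 2)^2 - D\<bar>)"
    unfolding ccc.LE_plus_CN_eq D_def[symmetric]
      sum_labels[of "\<lambda>s. \<bar>2 * (s - 1) * (s - 2) - D\<bar> + (s - 1) * \<bar>(s - 2)^2 - D\<bar>"] ..
  show ?thesis
  proof (cases "n = 3 \<or> n = 5 \<and> z = 1")
    case False
    \<comment> \<open>Even n gives k = n - 1 \<ge> 3; n = 5 gives k = 2 and b = z \<ge> 2; odd n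
      \<ge> 7 gives k \<ge> 3.\<close>
    have "t = 1 \<and> k = 2 \<and> b \<ge> 2 \<or> t = 1 \<and> k \<ge> 3 \<or> t = 2 \<and> k \<ge> 3"
    proof (cases "even n")
      case True
      then have "n \<ge> 4" using n_ge_3 by (cases "n = 3") auto
      then show ?thesis using True by (simp add: t_def k_def)
    next
      case odd: False
      then have "n \<noteq> 4" "n \<noteq> 6" by auto
      then consider "n = 5" "z \<ge> 2" | "n \<ge> 7" using False n_ge_3 z by linarith
      then show ?thesis using odd t by cases (simp_all add: t_def k_def)
    qed
    from clique_energies_less[OF b_nat ak this D E L P] show ?thesis
      using False z by blast
  next
    case True
    then have t1: "t = 1" by (auto simp: t_def)
    from True have "E_CN (ccc_graph G) = LE_CN (ccc_graph G) \<and> LE_CN (ccc_graph G) = LE_plus_CN (ccc_graph G)"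
    proof
      assume "n = 3"
      \<comment> \<open>Two cliques of equal size: the row sums are constant, and every energy
        equals 4 (b - 1) \<bar>b - 2\<bar>.\<close>
      then have ab: "a = b" using ak t1 by (simp add: k_def)
      have Db: "D = (b - 1) * (b - 2)"
        unfolding D ab t1 using b_nat by (auto simp: field_simps)
      then have diffs: "b * (b - 2) - D = b - 2" "(b - 2)^2 - D = - (b - 2)"
        "2 * (b - 1) * (b - 2) - D = (b - 1) * (b - 2)"
        by (simp_all add: algebra_simps power2_eq_square)
      have "\<bar>(b - 1) * (b - 2)\<bar> = (b - 1) * \<bar>b - 2\<bar>" "\<bar>- (b - 2)\<bar> = \<bar>b - 2\<bar>"
        using b_nat by (auto simp: abs_mult)
      moreover from this have "\<bar>D\<bar> = (b - 1) * \<bar>b - 2\<bar>" unfolding Db by simp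
      ultimately show ?thesis unfolding E L P ab t1 diffs by simp
    next
      assume "n = 5 \<and> z = 1"
      \<comment> \<open>The cliques have sizes 2 and 1, so there are no common neighbours and all
        energies vanish.\<close>
      then have "b = 1" "a = 2" using t t1 ak by (simp_all add: k_def)
      then show ?thesis unfolding E L P D t1 by simp
    qed
    then show ?thesis using True z by blast
  qed
qed

end
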